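(* Let $(T,d_T)$ be a metric tree and let $G=(V,E)$ be a finite connected (unweighted) graph. Let $\Omega\subseteq V$ and let $f:V\to T$ be $\infty$-harmonic on $V\setminus\Omega$. Then the linear interpolation of $f$, which is a $T$-valued function on the $1$-dimensional simplicial complex associated to $G$, is an AMLE of $f|_\Omega$.
   Context: A metric tree is the one-dimensional simplicial complex associated to a finite graph-theoretical tree with arbitrary (positive, finite) edge lengths, with edges present as actual intervals of the given lengths, equipped with the shortest-path metric $d_T$. The finite connected graph $G=(V,E)$ is also regarded as a $1$-dimensional simplicial complex (still denoted $G$), in which each edge is an interval of length $1$ joining its endpoints; with the shortest-path metric $d_G$ it is a length space. For $v\in V$, $N_G(v)=\{u\in V: uv\in E\}$. For a metric space $(Z,d_Z)$, a function $f:V\to Z$ is $\infty$-harmonic at $v\in V$ if there exist $u,w\in N_G(v)$ such that $$d_Z(f(u),f(v))=d_Z(f(w),f(v))=\max_{z\in N_G(v)}d_Z(f(z),f(v))\quad\text{and}\quad d_Z(f(u),f(w))=2\max_{z\in N_G(v)}d_Z(f(z),f(v)).$$ It is $\infty$-harmonic on $W\subseteq V$ if it is $\infty$-harmonic at every $v\in W$. The linear interpolation of $f:V\to T$ is the function on the simplicial complex $G$ defined as follows: for an edge $uv\in E$ and a point $x$ of this edge with $d_G(x,u)=\lambda$ and $d_G(x,v)=1-\lambda$ (distances measured along the edge), its value at $x$ is the point $p$ on the geodesic of $T$ joining $f(u)$ and $f(v)$ with $d_T(p,f(u))=\lambda d_T(f(u),f(v))$ and $d_T(p,f(v))=(1-\lambda)d_T(f(u),f(v))$.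 For metric spaces $(X,d_X)$, $(Z,d_Z)$, $h:X\to Z$ and $S\subseteq X$, put $\mathrm{Lip}_S(h)=\sup_{x,y\in S,\ x\neq y}\frac{d_Z(h(x),h(y))}{d_X(x,y)}$ (with value $0$ if $S$ has fewer than two points). Given a closed $Y\subseteq X$ and a Lipschitz mapping $f:Y\to Z$, a Lipschitz mapping $\widetilde f:X\to Z$ is an absolutely minimal Lipschitz extension (AMLE) of $f$ if $\widetilde f|_Y=f$ and for every open $U\subseteq X\setminus Y$ and every Lipschitz $h:X\to Z$ that coincides with $\widetilde f$ on $X\setminus U$ one has $\mathrm{Lip}_U(h)\ge\mathrm{Lip}_U(\widetilde f)$. Here this is applied with $X=G$ (the simplicial complex with metric $d_G$), $Y=\Omega$, $Z=T$. *)

theory Defs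
  imports "HOL-Analysis.Analysis"
begin

section \<open>Finite graphs and trees\<close>

definition finite_simple_graph :: "'v set \<Rightarrow> 'v set set \<Rightarrow> bool" where
  "finite_simple_graph V E \<longleftrightarrow> finite V \<and> (\<forall>e\<in>E. e \<subseteq> V \<and> card e = 2)"

definition finite_connected_graph :: "'v set \<Rightarrow> 'v set set \<Rightarrow> bool" where
  "finite_connected_graph V E \<longleftrightarrow>
     finite_simple_graph V E \<and> V \<noteq> {} \<and> (\<forall>u\<in>V. \<forall>v\<in>V. (u, v) \<in> {(a, b). {a, b} \<in> E}\<^sup>*)"

definition graph_cycle :: "'v set set \<Rightarrow> 'v list \<Rightarrow> bool" where
  "graph_cycle E p \<longleftrightarrow>
     length p \<ge> 3 \<and> distinct p \<and> (\<forall>i<length p. {p ! i, p ! (Suc i mod length p)} \<in> E)"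

definition finite_tree :: "'v set \<Rightarrow> 'v set set \<Rightarrow> bool" where
  "finite_tree V E \<longleftrightarrow> finite_connected_graph V E \<and> (\<nexists>p. graph_cycle E p)"

definition nbhd :: "'v set set \<Rightarrow> 'v \<Rightarrow> 'v set" where
  "nbhd E v = {u. {u, v} \<in> E}"


section \<open>The one-dimensional simplicial complex of a graph with edge lengths\<close>

text \<open>
  Points of the complex are given by barycentric coordinates: a point of the edge \<open>{u, v}\<close> is a
  function \<open>x\<close> with \<open>x u, x v \<ge> 0\<close> and \<open>x u + x v = 1\<close> that vanishes at all other vertices.
\<close>

definition vertex :: "'v \<Rightarrow> 'v \<Rightarrow> real" where
  "vertex v = (\<lambda>w. if w = v then 1 else 0)"

definition edge_points :: "'v set \<Rightarrow> ('v \<Rightarrow> real) set" where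
  "edge_points e = {x. (\<forall>v\<in>e. x v \<ge> 0) \<and> (\<forall>v. v \<notin> e \<longrightarrow> x v = 0) \<and> (\<Sum>v\<in>e. x v) = 1}"

definition complex_points :: "'v set \<Rightarrow> 'v set set \<Rightarrow> ('v \<Rightarrow> real) set" where
  "complex_points V E = vertex ` V \<union> (\<Union>e\<in>E. edge_points e)"

text \<open>
  Distance measured along the edge \<open>e\<close>, as an interval of length \<open>l\<close>. The two summands
  agree, since the coordinates of \<open>x\<close> and of \<open>y\<close> on \<open>e\<close> both sum to 1.
\<close>

definition edge_dist :: "real \<Rightarrow> 'v set \<Rightarrow> ('v \<Rightarrow> real) \<Rightarrow> ('v \<Rightarrow> real) \<Rightarrow> real" where
  "edge_dist l e x y = l * (\<Sum>v\<in>e. \<bar>x v - y v\<bar>) / 2"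

text \<open>
  \<open>piecewise_path E len x y L\<close>: there is a path of length \<open>L\<close> from \<open>x\<close> to \<open>y\<close> that is a
  concatenation of finitely many segments, each contained in a single edge.
\<close>

inductive piecewise_path ::
    "'v set set \<Rightarrow> ('v set \<Rightarrow> real) \<Rightarrow> ('v \<Rightarrow> real) \<Rightarrow> ('v \<Rightarrow> real) \<Rightarrow> real \<Rightarrow> bool"
  for E len where
  refl: "piecewise_path E len x x 0"
| step: "\<lbrakk>e \<in> E; x \<in> edge_points e; y \<in> edge_points e; piecewise_path E len y z L\<rbrakk>
    \<Longrightarrow> piecewise_path E len x z (edge_dist (len e) e x y + L)"

definition shortest_path_dist ::
    "'v set set \<Rightarrow> ('v set \<Rightarrow> real) \<Rightarrow> ('v \<Rightarrow> real) \<Rightarrow> ('v \<Rightarrow> real) \<Rightarrow> real" where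
  "shortest_path_dist E len x y =
     (if \<exists>L. piecewise_path E len x y L then Inf {L. piecewise_path E len x y L} else 0)"

text \<open>
  The value 0 in the absence of a path is a dummy: the locale \<open>Metric_space\<close> asks for
  nonnegativity also off the carrier, and \<open>Inf {}\<close> is unspecified on the reals.
  For connected graphs with positive edge lengths this is indeed a metric space with the
  given carrier and distance; see the lemmas \<open>mspace_metric_complex\<close> and
  \<open>mdist_metric_complex\<close> below.
\<close>

definition metric_complex ::
    "'v set \<Rightarrow> 'v set set \<Rightarrow> ('v set \<Rightarrow> real) \<Rightarrow> ('v \<Rightarrow> real) metric" where
  "metric_complex V E len = metric (complex_points V E, shortest_path_dist E len)"

definition unit_complex :: "'v set \<Rightarrow> 'v set set \<Rightarrow> ('v \<Rightarrow> real) metric" where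
  "unit_complex V E = metric_complex V E (\<lambda>e. 1)"

definition metric_tree :: "('b \<Rightarrow> real) metric \<Rightarrow> bool" where
  "metric_tree T \<longleftrightarrow>
     (\<exists>V E len. finite_tree V E \<and> (\<forall>e\<in>E. len e > 0) \<and> T = metric_complex V E len)"

lemma edge_dist_commute: "edge_dist l e x y = edge_dist l e y x"
  by (simp add: edge_dist_def abs_minus_commute)

lemma edge_dist_nonneg: "l \<ge> 0 \<Longrightarrow> edge_dist l e x y \<ge> 0"
  by (simp add: edge_dist_def sum_nonneg)

lemma piecewise_path_append:
  assumes "piecewise_path E len x y L" "piecewise_path E len y z L'"
  shows "piecewise_path E len x z (L + L')"
  using assms
proof induction
  case (refl x)
  then show ?case by simp
next
  case (step e x y w L)
  then show ?case
    using piecewise_path.step[of e E x y len z "L + L'"] by (simp add: add.assoc)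
qed

lemma piecewise_path_sym:
  assumes "piecewise_path E len x y L"
  shows "piecewise_path E len y x L"
  using assms
proof induction
  case (refl x)
  then show ?case by (rule piecewise_path.refl)
next
  case (step e x y z L)
  have "piecewise_path E len y x (edge_dist (len e) e y x + 0)"
    using step by (intro piecewise_path.step piecewise_path.refl) auto
  with step.IH have "piecewise_path E len z x (L + (edge_dist (len e) e y x + 0))"
    by (rule piecewise_path_append)
  then show ?case by (simp add: edge_dist_commute add.commute)
qed

lemma edge_dist_lower:
  assumes "card e = 2" "x \<in> edge_points e" "y \<in> edge_points e" "0 \<le> m" "m \<le> l"
  shows "m * \<bar>x v - y v\<bar> \<le> edge_dist l e x y"
proof -
  obtain a b where e: "e = {a, b}" "a \<noteq> b"
    using assms(1) by (auto simp: card_2_iff)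
  have s: "x a + x b = 1" "y a + y b = 1"
    using assms(2,3) e by (auto simp: edge_points_def)
  then have ab: "\<bar>x b - y b\<bar> = \<bar>x a - y a\<bar>" by linarith
  have d: "edge_dist l e x y = l * \<bar>x a - y a\<bar>"
    using e ab by (simp add: edge_dist_def)
  have "\<bar>x v - y v\<bar> \<le> \<bar>x a - y a\<bar>"
    using assms(2,3) e ab by (cases "v \<in> e") (auto simp: edge_points_def)
  then show ?thesis
    unfolding d using assms(4,5) by (intro mult_mono) auto
qed

lemma piecewise_path_lower:
  assumes "piecewise_path E len x y L"
    and "\<forall>e\<in>E. card e = 2" "0 \<le> m" "\<forall>e\<in>E. m \<le> len e"
  shows "m * \<bar>x v - y v\<bar> \<le> L"
  using assms(1)
proof induction
  case (refl x)
  then show ?case by simp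
next
  case (step e x y z L)
  have "m * \<bar>x v - y v\<bar> \<le> edge_dist (len e) e x y"
    using step assms(2-4) by (intro edge_dist_lower) auto
  moreover have "m * \<bar>x v - z v\<bar> \<le> m * (\<bar>x v - y v\<bar> + \<bar>y v - z v\<bar>)"
    using assms(3) by (intro mult_left_mono) auto
  ultimately show ?case
    using step.IH by (simp add: distrib_left)
qed

lemma vertex_in_edge_points:
  assumes "card e = 2" "v \<in> e"
  shows "vertex v \<in> edge_points e"
proof -
  have "finite e" using assms(1) by (metis card.infinite zero_neq_numeral)
  then show ?thesis using assms(2) by (auto simp: edge_points_def vertex_def)
qed

lemma piecewise_path_to_vertex:
  assumes "finite_simple_graph V E" "x \<in> complex_points V E"
  shows "\<exists>v\<in>V. \<exists>L. piecewise_path E len x (vertex v) L"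
proof (cases "x \<in> vertex ` V")
  case True
  then show ?thesis by (auto intro: piecewise_path.refl)
next
  case False
  then obtain e where e: "e \<in> E" "x \<in> edge_points e"
    using assms(2) by (auto simp: complex_points_def)
  with assms(1) have c: "card e = 2" "e \<subseteq> V" by (auto simp: finite_simple_graph_def)
  then obtain v where v: "v \<in> e" by (auto simp: card_2_iff)
  show ?thesis
    using piecewise_path.step[OF e(1,2) vertex_in_edge_points[OF c(1) v] piecewise_path.refl]
      v c(2) by blast
qed

lemma piecewise_path_exists:
  assumes G: "finite_connected_graph V E"
    and x: "x \<in> complex_points V E" and y: "y \<in> complex_points V E"
  shows "\<exists>L. piecewise_path E len x y L"
proof -
  have S: "finite_simple_graph V E" using G by (simp add: finite_connected_graph_def)
  obtain u L where u: "u \<in> V" "piecewise_path E len x (vertex u) L"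
    using piecewise_path_to_vertex[OF S x] by blast
  obtain v L' where v: "v \<in> V" "piecewise_path E len y (vertex v) L'"
    using piecewise_path_to_vertex[OF S y] by blast
  have "(u, v) \<in> {(a, b). {a, b} \<in> E}\<^sup>*"
    using G u v by (simp add: finite_connected_graph_def)
  then have "\<exists>K. piecewise_path E len (vertex u) (vertex v) K"
  proof induction
    case base
    show ?case by (blast intro: piecewise_path.refl)
  next
    case (step b c)
    then obtain K where K: "piecewise_path E len (vertex u) (vertex b) K" by blast
    have e: "{b, c} \<in> E" "card {b, c} = 2"
      using step S by (auto simp: finite_simple_graph_def)
    have "vertex b \<in> edge_points {b, c}" "vertex c \<in> edge_points {b, c}"
      using e(2) by (auto intro!: vertex_in_edge_points)
    from piecewise_path.step[OF e(1) this piecewise_path.refl] K show ?case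
      using piecewise_path_append by blast
  qed
  with u v show ?thesis
    by (meson piecewise_path_append piecewise_path_sym)
qed

lemma Metric_space_complex:
  assumes G: "finite_connected_graph V E" and len: "\<forall>e\<in>E. len e > 0"
  shows "Metric_space (complex_points V E) (shortest_path_dist E len)"
proof -
  let ?d = "shortest_path_dist E len"
  have S: "finite V" "\<forall>e\<in>E. e \<subseteq> V \<and> card e = 2"
    using G by (auto simp: finite_connected_graph_def finite_simple_graph_def)
  then have "E \<subseteq> Pow V" by blast
  then have finE: "finite E" using S(1) by (simp add: finite_subset)
  define m where "m = Min (insert 1 (len ` E))"
  have m: "m > 0" "\<forall>e\<in>E. m \<le> len e"
    using finE len by (auto simp: m_def)
  have lower: "m * \<bar>x v - y v\<bar> \<le> L" if "piecewise_path E len x y L" for x y v L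
    using piecewise_path_lower[OF that] S m by auto
  have nonneg: "0 \<le> L" if "piecewise_path E len x y L" for x y L
    using lower[OF that, of undefined] m(1) by (smt (verit) mult_nonneg_nonneg abs_ge_zero)
  have bdd: "bdd_below {L. piecewise_path E len x y L}" for x y
    using nonneg by (intro bdd_belowI[of _ 0]) auto
  have ne: "\<exists>L. piecewise_path E len x y L"
    if "x \<in> complex_points V E" "y \<in> complex_points V E" for x y
    using piecewise_path_exists[OF G that] .
  have d_le: "?d x y \<le> L" if "piecewise_path E len x y L" for x y L
    using that cInf_lower[OF _ bdd, of L x y] by (auto simp: shortest_path_dist_def)
  have d_ge: "c \<le> ?d x y"
    if "\<exists>L. piecewise_path E len x y L" "\<And>L. piecewise_path E len x y L \<Longrightarrow> c \<le> L" for c x y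
  proof -
    have "c \<le> Inf {L. piecewise_path E len x y L}"
      using that by (intro cInf_greatest) auto
    then show ?thesis using that(1) by (simp add: shortest_path_dist_def)
  qed
  have nn: "0 \<le> ?d x y" for x y
  proof (cases "\<exists>L. piecewise_path E len x y L")
    case True
    then show ?thesis using nonneg by (intro d_ge) auto
  qed (simp add: shortest_path_dist_def)
  have "piecewise_path E len x y L \<longleftrightarrow> piecewise_path E len y x L" for x y L
    using piecewise_path_sym by blast
  then have comm: "?d x y = ?d y x" for x y
    by (simp add: shortest_path_dist_def)
  have refl: "?d x x = 0" for x
    using d_le[OF piecewise_path.refl] nn by (metis antisym)
  have eq: "x = y"
    if xy: "x \<in> complex_points V E" "y \<in> complex_points V E" and "?d x y = 0" for x y
  proof
    fix v
    have "m * \<bar>x v - y v\<bar> \<le> ?d x y"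
      using ne[OF xy] lower by (rule d_ge)
    with that(3) m(1) show "x v = y v" by (simp add: mult_le_0_iff)
  qed
  have tri: "?d x z \<le> ?d x y + ?d y z"
    if x: "x \<in> complex_points V E" and y: "y \<in> complex_points V E"
      and z: "z \<in> complex_points V E" for x y z
  proof -
    have 1: "?d x z - L \<le> ?d y z" if L: "piecewise_path E len x y L" for L
    proof (rule d_ge[OF ne[OF y z]])
      fix K assume "piecewise_path E len y z K"
      with L have "?d x z \<le> L + K" by (blast intro: d_le piecewise_path_append)
      then show "?d x z - L \<le> K" by simp
    qed
    have "?d x z - ?d y z \<le> ?d x y"
    proof (rule d_ge[OF ne[OF x y]])
      fix L assume "piecewise_path E len x y L"
      from 1[OF this] show "?d x z - ?d y z \<le> L" by simp
    qed
    then show ?thesis by simp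
  qed
  show ?thesis
    by (rule Metric_space.intro) (use nn comm refl eq tri in auto)
qed

lemma mspace_metric_complex:
  assumes "finite_connected_graph V E" "\<forall>e\<in>E. len e > 0"
  shows "mspace (metric_complex V E len) = complex_points V E"
  unfolding metric_complex_def
  using Metric_space_complex[OF assms] by (rule Metric_space.mspace_metric)

lemma mdist_metric_complex:
  assumes "finite_connected_graph V E" "\<forall>e\<in>E. len e > 0"
  shows "mdist (metric_complex V E len) = shortest_path_dist E len"
  unfolding metric_complex_def
  using Metric_space_complex[OF assms] by (rule Metric_space.mdist_metric)

lemma inj_vertex: "inj vertex"
proof (rule injI)
  fix u v :: 'a
  assume "vertex u = vertex v"
  then have "vertex u u = vertex v u" by simp
  then show "u = v" by (simp add: vertex_def split: if_splits)
qed


section \<open>Infinity-harmonic maps, linear interpolation and AMLEs\<close>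

definition inf_harmonic_at :: "'v set set \<Rightarrow> 'z metric \<Rightarrow> ('v \<Rightarrow> 'z) \<Rightarrow> 'v \<Rightarrow> bool" where
  "inf_harmonic_at E Z f v \<longleftrightarrow>
     (\<exists>u\<in>nbhd E v. \<exists>w\<in>nbhd E v.
        mdist Z (f u) (f v) = (MAX z\<in>nbhd E v. mdist Z (f z) (f v)) \<and>
        mdist Z (f w) (f v) = (MAX z\<in>nbhd E v. mdist Z (f z) (f v)) \<and>
        mdist Z (f u) (f w) = 2 * (MAX z\<in>nbhd E v. mdist Z (f z) (f v)))"

definition inf_harmonic_on :: "'v set set \<Rightarrow> 'z metric \<Rightarrow> ('v \<Rightarrow> 'z) \<Rightarrow> 'v set \<Rightarrow> bool" where
  "inf_harmonic_on E Z f W \<longleftrightarrow> (\<forall>v\<in>W. inf_harmonic_at E Z f v)"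

definition geodesic_segment :: "'z metric \<Rightarrow> 'z \<Rightarrow> 'z \<Rightarrow> 'z set \<Rightarrow> bool" where
  "geodesic_segment Z a b S \<longleftrightarrow>
     (\<exists>\<gamma>. \<gamma> \<in> {0..mdist Z a b} \<rightarrow> mspace Z \<and> \<gamma> 0 = a \<and> \<gamma> (mdist Z a b) = b \<and>
          (\<forall>s\<in>{0..mdist Z a b}. \<forall>t\<in>{0..mdist Z a b}. mdist Z (\<gamma> s) (\<gamma> t) = \<bar>s - t\<bar>) \<and>
          S = \<gamma> ` {0..mdist Z a b})"

text \<open>
  The value at a point \<open>x\<close> of the unit-length complex of \<open>(V, E)\<close>. The vertex clause
  only adds information when the graph is a single vertex without edges.
\<close>

definition linear_interpolation ::
    "'v set \<Rightarrow> 'v set set \<Rightarrow> 'z metric \<Rightarrow> ('v \<Rightarrow> 'z) \<Rightarrow> ('v \<Rightarrow> real) \<Rightarrow> 'z" where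
  "linear_interpolation V E Z f x =
     (THE p.
        (\<forall>v\<in>V. x = vertex v \<longrightarrow> p = f v) \<and>
        (\<forall>u v r. {u, v} \<in> E \<and> x \<in> edge_points {u, v} \<and>
            edge_dist 1 {u, v} x (vertex u) = r \<and> edge_dist 1 {u, v} x (vertex v) = 1 - r \<longrightarrow>
          (\<exists>S. geodesic_segment Z (f u) (f v) S \<and> p \<in> S) \<and>
          mdist Z p (f u) = r * mdist Z (f u) (f v) \<and>
          mdist Z p (f v) = (1 - r) * mdist Z (f u) (f v)))"

text \<open>With values in \<open>ennreal\<close> the supremum over the empty set is 0.\<close>

definition Lip_on :: "'x metric \<Rightarrow> 'z metric \<Rightarrow> 'x set \<Rightarrow> ('x \<Rightarrow> 'z) \<Rightarrow> ennreal" where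
  "Lip_on X Z S h =
     (SUP (x, y)\<in>{(x, y). x \<in> S \<and> y \<in> S \<and> x \<noteq> y}. ennreal (mdist Z (h x) (h y) / mdist X x y))"

definition AMLE ::
    "'x metric \<Rightarrow> 'z metric \<Rightarrow> 'x set \<Rightarrow> ('x \<Rightarrow> 'z) \<Rightarrow> ('x \<Rightarrow> 'z) \<Rightarrow> bool" where
  "AMLE X Z Y f F \<longleftrightarrow>
     closedin (mtopology_of X) Y \<and>
     Lipschitz_continuous_map (submetric X Y) Z f \<and>
     Lipschitz_continuous_map X Z F \<and>
     (\<forall>y\<in>Y. F y = f y) \<and>
     (\<forall>U h. openin (mtopology_of X) U \<and> U \<subseteq> mspace X - Y \<and>
        Lipschitz_continuous_map X Z h \<and> (\<forall>x\<in>mspace X - U. h x = F x) \<longrightarrow>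
        Lip_on X Z U h \<ge> Lip_on X Z U F)"

end

(*
Let U be open and disjoint from \<Omega>, let h agree with the interpolation F of f off U, and suppose that
Lip h \<le> K on U.  By continuity h is K-Lipschitz on the boundary of U, hence so is F.  If F had slope
s > K on a piece of an edge inside U, follow F from there in both directions: at each vertex in U,
harmonicity provides a next edge that is at least as steep and whose image points away from the
image of the walk so far.  In a tree local geodesics are geodesics, so the image is a geodesic of
speed at least s; as f has bounded image, the walk leaves U at both ends, and its two exit points
violate the K-Lipschitz bound.  So all slopes inside U are at most K, and cutting an almost
shortest path between two points of U at its first and last exit from U yields Lip F \<le> K on U.

The properties of the tree that are used are that it is geodesic and satisfies the four-point
condition; both follow by induction on the number of edges, adding one leaf at a time.
*)
theory Submission
  imports Defs
begin

section \<open>Lengths of paths in a complex\<close>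

text \<open>The two opposite neighbours that harmonicity provides at a vertex leave its image in
  different directions of the tree. The point the walk comes from lies in at most one of them, so
  the other one prolongs the walk; this is a single application of the four-point condition. The
  graph may contain cycles, and the walk need not be a shortest path in it: a lower bound on the
  stretch of \<open>F\<close> only takes the upper bound of \<open>d\<close> by the length of the
  walk, whereas the lengths of the images add up exactly in the tree. The same additivity keeps the
  walk from circling, since its image recedes from that of a fixed vertex by at least
  \<open>s\<close> per edge. To avoid concatenating curves in \<open>T\<close>, all this is phrased
  through equalities of distances (\<open>between\<close>). The four-point condition also makes a
  point of a geodesic unique given its distances to the endpoints, and so makes the interpolation
  well defined.\<close>

lemma shortest_path_dist_eqI:
  assumes "piecewise_path E len x y L"
    and "\<And>K. piecewise_path E len x y K \<Longrightarrow> L \<le> K"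
  shows "shortest_path_dist E len x y = L"
proof -
  have "Inf {L. piecewise_path E len x y L} = L"
    using assms by (intro cInf_eq_minimum) auto
  then show ?thesis using assms(1) by (auto simp: shortest_path_dist_def)
qed

lemma piecewise_path_nonneg:
  assumes "piecewise_path E len x y L" "\<forall>e\<in>E. 0 \<le> len e"
  shows "0 \<le> L"
  using assms by induction (auto intro!: add_nonneg_nonneg edge_dist_nonneg)

lemma shortest_path_dist_le:
  assumes "piecewise_path E len x y L" "\<forall>e\<in>E. 0 \<le> len e"
  shows "shortest_path_dist E len x y \<le> L"
proof -
  have "bdd_below {L. piecewise_path E len x y L}"
    using piecewise_path_nonneg[OF _ assms(2)] by (intro bdd_belowI[of _ 0]) auto
  then show ?thesis
    using assms(1) by (auto simp: shortest_path_dist_def intro: cInf_lower)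
qed

lemma piecewise_path_approx:
  assumes "piecewise_path E len x y L" "shortest_path_dist E len x y < c"
  shows "\<exists>K<c. piecewise_path E len x y K"
proof -
  have "Inf {L. piecewise_path E len x y L} < c"
    using assms by (auto simp: shortest_path_dist_def split: if_splits)
  then show ?thesis
    using cInf_lessD[of "{L. piecewise_path E len x y L}" c] assms(1) by auto
qed

lemma piecewise_path_mono:
  assumes "piecewise_path E len x y L" "E \<subseteq> E'"
  shows "piecewise_path E' len x y L"
  using assms by induction (auto intro: piecewise_path.intros)

lemma piecewise_path_edge:
  assumes "e \<in> E" "x \<in> edge_points e" "y \<in> edge_points e"
  shows "piecewise_path E len x y (edge_dist (len e) e x y)"
  using piecewise_path.step[OF assms piecewise_path.refl, of len] by simp

lemma edge_points_doubleton:
  assumes "u \<noteq> v"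
  shows "x \<in> edge_points {u, v} \<longleftrightarrow>
    0 \<le> x u \<and> 0 \<le> x v \<and> x u + x v = 1 \<and> (\<forall>w. w \<noteq> u \<longrightarrow> w \<noteq> v \<longrightarrow> x w = 0)"
  using assms by (auto simp: edge_points_def)

lemma edge_dist_doubleton:
  assumes "u \<noteq> v" "x \<in> edge_points {u, v}" "y \<in> edge_points {u, v}"
  shows "edge_dist l {u, v} x y = l * \<bar>x v - y v\<bar>"
proof -
  have "\<bar>x u - y u\<bar> = \<bar>x v - y v\<bar>"
    using assms by (auto simp: edge_points_doubleton)
  then show ?thesis using assms(1) by (simp add: edge_dist_def)
qed

section \<open>Trees grown by adding leaves\<close>

text \<open>Acyclicity offers no induction; here every step attaches one new edge at an old vertex,
  and the metric of the complex can be followed through that step.\<close>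

inductive grown_tree :: "'v set \<Rightarrow> 'v set set \<Rightarrow> bool" where
  singleton: "grown_tree {r} {}"
| add_leaf: "\<lbrakk>grown_tree V E; u \<in> V; v \<notin> V\<rbrakk> \<Longrightarrow> grown_tree (insert v V) (insert {u, v} E)"

definition simple_path :: "'v set set \<Rightarrow> 'v \<Rightarrow> 'v \<Rightarrow> 'v list \<Rightarrow> bool" where
  "simple_path E a b p \<longleftrightarrow>
     p \<noteq> [] \<and> hd p = a \<and> last p = b \<and> distinct p \<and> successively (\<lambda>x y. {x, y} \<in> E) p"

lemma grown_tree_simple_graph:
  "grown_tree V E \<Longrightarrow> finite_simple_graph V E"
  by (induction rule: grown_tree.induct) (auto simp: finite_simple_graph_def card_insert_if)

lemma grown_tree_simple_path:
  assumes "grown_tree V E" "a \<in> V" "b \<in> V"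
  shows "\<exists>p. simple_path E a b p \<and> set p \<subseteq> V"
  using assms
proof (induction arbitrary: a b rule: grown_tree.induct)
  case (singleton r)
  then show ?case by (intro exI[of _ "[r]"]) (auto simp: simple_path_def)
next
  case (add_leaf V E u v)
  have mono: "simple_path (insert {u, v} E) x y p" if "simple_path E x y p" for x y p
    using that by (auto simp: simple_path_def elim: successively_mono)
  consider "a \<in> V" "b \<in> V" | "a = v" "b = v" | "a = v" "b \<in> V" | "a \<in> V" "b = v"
    using add_leaf.prems by blast
  then show ?case
  proof cases
    case 1
    then show ?thesis using add_leaf.IH mono by blast
  next
    case 2
    then show ?thesis by (intro exI[of _ "[v]"]) (auto simp: simple_path_def)
  next
    case 3
    then obtain p where p: "simple_path E u b p" "set p \<subseteq> V"
      using add_leaf.IH add_leaf.hyps by blast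
    then have "simple_path (insert {u, v} E) v b (v # p)"
      using mono[OF p(1)] add_leaf.hyps 3
      by (auto simp: simple_path_def successively_Cons insert_commute)
    then show ?thesis using p 3 by (intro exI[of _ "v # p"]) auto
  next
    case 4
    then obtain p where p: "simple_path E a u p" "set p \<subseteq> V"
      using add_leaf.IH add_leaf.hyps by blast
    then have "simple_path (insert {u, v} E) a v (p @ [v])"
      using mono[OF p(1)] add_leaf.hyps 4
      by (auto simp: simple_path_def successively_append_iff)
    then show ?thesis using p 4 by (intro exI[of _ "p @ [v]"]) auto
  qed
qed

text \<open>\<open>a \<noteq> b\<close> gives \<open>p\<close> at least two vertices, so the closed
  list reaches the length 3 required of a cycle. Its edges are those of \<open>p\<close>, the one
  from \<open>b\<close> to \<open>v\<close>, and the wrap-around from \<open>v\<close> to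
  \<open>a\<close>.\<close>

lemma graph_cycle_closing_path:
  assumes p: "simple_path E a b p" and "v \<notin> set p" "a \<noteq> b" "{a, v} \<in> E" "{b, v} \<in> E"
  shows "graph_cycle E (p @ [v])"
proof -
  have "p \<noteq> []" and hl: "p ! 0 = a" "p ! (length p - 1) = b"
    using p by (auto simp: simple_path_def hd_conv_nth last_conv_nth)
  then have len: "length p \<ge> 2"
    using assms(3) by (cases p rule: remdups_adj.cases) auto
  have "{(p @ [v]) ! i, (p @ [v]) ! (Suc i mod length (p @ [v]))} \<in> E" if "i < length (p @ [v])" for i
  proof -
    consider "Suc i < length p" | "i = length p - 1" | "i = length p"
      using \<open>i < length (p @ [v])\<close> by fastforce
    then show ?thesis
    proof cases
      case 1
      then have "{p ! i, p ! Suc i} \<in> E"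
        using p by (auto simp: simple_path_def successively_conv_nth)
      with 1 show ?thesis by (simp add: nth_append)
    next
      case 2
      then have "Suc i = length p" using len by simp
      with 2 len hl(2) assms(5) show ?thesis by (simp add: nth_append)
    next
      case 3
      with len hl(1) \<open>p \<noteq> []\<close> assms(4) show ?thesis by (simp add: nth_append insert_commute)
    qed
  qed
  with len p assms(2) show ?thesis by (auto simp: graph_cycle_def simple_path_def)
qed

lemma rtrancl_leaves_set:
  assumes "(a, b) \<in> R\<^sup>*" "a \<in> W" "b \<notin> W"
  shows "\<exists>x y. (x, y) \<in> R \<and> x \<in> W \<and> y \<notin> W"
  using assms by (induction rule: rtrancl_induct) auto

text \<open>A maximal \<open>W\<close> whose induced subgraph is grown must be everything:
  connectedness gives an edge from \<open>W\<close> to some \<open>v\<close> outside, and acyclicity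
  makes it the only one, so \<open>v\<close> could be added as a leaf.\<close>

lemma grown_tree_if_finite_tree:
  assumes "finite_tree V E"
  shows "grown_tree V E"
proof -
  have S: "finite V" "\<And>e. e \<in> E \<Longrightarrow> e \<subseteq> V" "\<And>e. e \<in> E \<Longrightarrow> card e = 2" "V \<noteq> {}"
    and conn: "\<And>a b. a \<in> V \<Longrightarrow> b \<in> V \<Longrightarrow> (a, b) \<in> {(a, b). {a, b} \<in> E}\<^sup>*"
    and acyc: "\<And>p. \<not> graph_cycle E p"
    using assms by (auto simp: finite_tree_def finite_connected_graph_def finite_simple_graph_def)
  let ?P = "\<lambda>W. W \<subseteq> V \<and> grown_tree W {e \<in> E. e \<subseteq> W}"
  obtain r where r: "r \<in> V" using S by blast
  have False if "e \<in> E" "e \<subseteq> {r}" for e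
    using card_mono[OF _ that(2)] S(3)[OF that(1)] by simp
  then have "{e \<in> E. e \<subseteq> {r}} = {}" by blast
  then have P0: "?P {r}" using r grown_tree.singleton[of r] by (simp only:) simp
  have "finite {W. ?P W}" by (rule finite_subset[of _ "Pow V"]) (use S(1) in auto)
  moreover have "{W. ?P W} \<noteq> {}" using P0 by blast
  ultimately obtain W where "W \<in> {W. ?P W}" and "\<forall>W'\<in>{W. ?P W}. W \<subseteq> W' \<longrightarrow> W = W'"
    by (rule finite_has_maximal[THEN bexE])
  then have W: "?P W" and max: "\<And>W'. ?P W' \<Longrightarrow> W \<subseteq> W' \<Longrightarrow> W = W'" by auto
  have "W = V"
  proof (rule ccontr)
    assume "W \<noteq> V"
    then obtain b where b: "b \<in> V" "b \<notin> W" using W by blast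
    have "W \<noteq> {}" using W by (auto elim: grown_tree.cases)
    then obtain a where "a \<in> W" by blast
    with conn[of a b] b W obtain u v where uv: "{u, v} \<in> E" "u \<in> W" "v \<notin> W"
      using rtrancl_leaves_set[of a b "{(a, b). {a, b} \<in> E}" W] by blast
    \<comment> \<open>A second neighbour of \<open>v\<close> in \<open>W\<close> would close a cycle
      with a path inside \<open>W\<close>.\<close>
    have "u' = u" if u': "{u', v} \<in> E" "u' \<in> W" for u'
    proof (rule ccontr)
      assume "u' \<noteq> u"
      obtain p where p: "simple_path {e \<in> E. e \<subseteq> W} u' u p" "set p \<subseteq> W"
        using grown_tree_simple_path[OF conjunct2[OF W] u'(2) uv(2)] by blast
      then have "simple_path E u' u p"
        by (auto simp: simple_path_def elim: successively_mono)
      then have "graph_cycle E (p @ [v])"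
        by (rule graph_cycle_closing_path) (use \<open>u' \<noteq> u\<close> u' uv p(2) in auto)
      with acyc show False by blast
    qed
    moreover have "\<exists>u'\<in>W. e = {u', v}" if e: "e \<in> E" "e \<subseteq> insert v W" "\<not> e \<subseteq> W" for e
    proof -
      obtain x y where "e = {x, y}" "x \<noteq> y" using S(3)[OF e(1)] by (auto simp: card_2_iff)
      with e show ?thesis by (auto simp: insert_commute)
    qed
    ultimately have *: "e = {u, v}" if "e \<in> E" "e \<subseteq> insert v W" "\<not> e \<subseteq> W" for e
      using that by metis
    have "e \<in> E \<and> e \<subseteq> insert v W \<longleftrightarrow> e = {u, v} \<or> e \<in> E \<and> e \<subseteq> W" for e
      using *[of e] uv by blast
    then have "{e \<in> E. e \<subseteq> insert v W} = insert {u, v} {e \<in> E. e \<subseteq> W}"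
      by (simp add: set_eq_iff)
    then have "grown_tree (insert v W) {e \<in> E. e \<subseteq> insert v W}"
      using grown_tree.add_leaf[OF conjunct2[OF W] uv(2,3)] by (simp only:)
    then have "?P (insert v W)" using conjunct1[OF W] S(2)[OF uv(1)] by simp
    then show False using max[of "insert v W"] uv by auto
  qed
  moreover have "{e \<in> E. e \<subseteq> V} = E" using S by blast
  ultimately show ?thesis using W by simp
qed

lemma grown_tree_connected:
  assumes "grown_tree V E"
  shows "finite_connected_graph V E"
proof -
  let ?R = "{(a, b). {a, b} \<in> E}"
  have "(hd p, last p) \<in> ?R\<^sup>*" if "p \<noteq> []" "successively (\<lambda>x y. {x, y} \<in> E) p" for p
    using that
  proof (induction p rule: induct_list012)
    case (3 x y zs)
    then have "(x, y) \<in> ?R" "(y, last (y # zs)) \<in> ?R\<^sup>*" by auto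
    then show ?case by (simp add: converse_rtrancl_into_rtrancl)
  qed auto
  then have "(a, b) \<in> ?R\<^sup>*" if "a \<in> V" "b \<in> V" for a b
    using grown_tree_simple_path[OF assms that] by (auto simp: simple_path_def)
  moreover have "V \<noteq> {}" using assms by (auto elim: grown_tree.cases)
  ultimately show ?thesis
    using grown_tree_simple_graph[OF assms] by (simp add: finite_connected_graph_def)
qed

text \<open>In barycentric coordinates, the retraction that crushes the new edge
  \<open>{u, v}\<close> to \<open>u\<close>: the weight at the leaf \<open>v\<close> is handed to
  \<open>u\<close>.\<close>

definition collapse :: "'v \<Rightarrow> 'v \<Rightarrow> ('v \<Rightarrow> real) \<Rightarrow> 'v \<Rightarrow> real" where
  "collapse u v x = x(u := x u + x v, v := 0)"

lemma collapse_leaf_edge: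
  assumes "u \<noteq> v" "x \<in> edge_points {u, v}"
  shows "collapse u v x = vertex u"
  using assms by (auto simp: collapse_def edge_points_doubleton vertex_def)

lemma collapse_id:
  assumes "x v = 0"
  shows "collapse u v x = x"
  using assms by (auto simp: collapse_def)

lemma complex_points_outside:
  assumes "finite_simple_graph V E" "x \<in> complex_points V E" "v \<notin> V"
  shows "x v = 0"
  using assms by (auto simp: complex_points_def finite_simple_graph_def vertex_def edge_points_def)

lemma complex_points_nonneg:
  assumes "x \<in> complex_points V E"
  shows "0 \<le> x v"
proof -
  consider u where "x = vertex u" | e where "x \<in> edge_points e"
    using assms by (auto simp: complex_points_def)
  then show ?thesis
  proof cases
    case 2
    then show ?thesis by (cases "v \<in> e") (auto simp: edge_points_def)
  qed (simp add: vertex_def)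
qed

lemma complex_points_add_leaf:
  assumes "finite_simple_graph V E" "u \<in> V" "v \<notin> V"
    and "x \<in> complex_points (insert v V) (insert {u, v} E)"
  shows "x \<in> complex_points V E \<and> x v = 0 \<and> collapse u v x = x \<or>
    x \<in> edge_points {u, v} \<and> collapse u v x = vertex u"
proof -
  have uv: "u \<noteq> v" using assms by blast
  have "vertex v \<in> edge_points {u, v}" using uv by (auto intro!: vertex_in_edge_points)
  then have "x \<in> complex_points V E \<or> x \<in> edge_points {u, v}"
    using assms(4) by (auto simp: complex_points_def)
  then show ?thesis
    using complex_points_outside[OF assms(1) _ assms(3)] collapse_id collapse_leaf_edge[OF uv]
    by metis
qed

text \<open>A segment in the new edge is crushed to a point and costs exactly its change of the
  coordinate at \<open>v\<close>; any other segment stays in place and has this coordinate 0. This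
  bounds distances in the enlarged tree from below.\<close>

lemma piecewise_path_collapse:
  assumes "piecewise_path (insert {u, v} E) len x y L"
    and "finite_simple_graph V E" "u \<in> V" "v \<notin> V" "0 < len {u, v}"
  shows "\<exists>K. piecewise_path E len (collapse u v x) (collapse u v y) K
    \<and> K + len {u, v} * \<bar>x v - y v\<bar> \<le> L"
  using assms(1)
proof induction
  case (refl x)
  then show ?case by (auto intro!: exI[of _ 0] piecewise_path.refl)
next
  case (step e x y z L)
  have uv: "u \<noteq> v" using assms by blast
  obtain K where K: "piecewise_path E len (collapse u v y) (collapse u v z) K"
    "K + len {u, v} * \<bar>y v - z v\<bar> \<le> L"
    using step.IH by blast
  have tri: "len {u, v} * \<bar>x v - z v\<bar> \<le> len {u, v} * \<bar>x v - y v\<bar> + len {u, v} * \<bar>y v - z v\<bar>"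
    using assms(5) by (simp add: distrib_left[symmetric])
  show ?case
  proof (cases "e = {u, v}")
    case True
    then have "edge_dist (len e) e x y = len {u, v} * \<bar>x v - y v\<bar>"
      "collapse u v x = collapse u v y"
      using step.hyps edge_dist_doubleton[OF uv] collapse_leaf_edge[OF uv] by auto
    with K tri show ?thesis by (intro exI[of _ K]) auto
  next
    case False
    then have e: "e \<in> E" using step.hyps by blast
    then have "v \<notin> e" using assms(2,4) by (auto simp: finite_simple_graph_def)
    then have 0: "x v = 0" "y v = 0" using step.hyps by (auto simp: edge_points_def)
    have "piecewise_path E len x (collapse u v z) (edge_dist (len e) e x y + K)"
      using piecewise_path.step[OF e step.hyps(2,3)] K(1) collapse_id[of y v u] 0(2) by simp
    with K 0 show ?thesis
      by (intro exI[of _ "edge_dist (len e) e x y + K"]) (auto simp: collapse_id)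
  qed
qed

text \<open>Gromov's four-point condition: of the three sums of distances of opposite pairs, the two
  largest agree.\<close>

definition zero_hyperbolic_on :: "'a set \<Rightarrow> ('a \<Rightarrow> 'a \<Rightarrow> real) \<Rightarrow> bool" where
  "zero_hyperbolic_on X d \<longleftrightarrow>
     (\<forall>x\<in>X. \<forall>y\<in>X. \<forall>z\<in>X. \<forall>w\<in>X. d x y + d z w \<le> max (d x z + d y w) (d x w + d y z))"

text \<open>Gluing a segment to the point \<open>q\<close>: \<open>p x\<close> is the retraction of \<open>x\<close> onto the old
  space and \<open>t x\<close> the position of \<open>x\<close> along the new segment.\<close>

lemma zero_hyperbolic_on_glue:
  fixes t :: "'a \<Rightarrow> real"
  assumes "Metric_space X d" "zero_hyperbolic_on X d" "q \<in> X"
    and p: "\<And>x. x \<in> Y \<Longrightarrow> p x \<in> X" and t: "\<And>x. x \<in> Y \<Longrightarrow> 0 \<le> t x"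
    and pt: "\<And>x. x \<in> Y \<Longrightarrow> t x = 0 \<or> p x = q"
    and d': "\<And>x y. x \<in> Y \<Longrightarrow> y \<in> Y \<Longrightarrow> d' x y = d (p x) (p y) + \<bar>t x - t y\<bar>"
  shows "zero_hyperbolic_on Y d'"
proof -
  interpret Metric_space X d by fact
  have "d' x y + d' z w \<le> max (d' x z + d' y w) (d' x w + d' y z)"
    if Y: "x \<in> Y" "y \<in> Y" "z \<in> Y" "w \<in> Y" for x y z w
  proof -
    have H: "d (p x) (p y) + d (p z) (p w) \<le>
      max (d (p x) (p z) + d (p y) (p w)) (d (p x) (p w) + d (p y) (p z))"
      using assms(2) Y p by (auto simp: zero_hyperbolic_on_def)
    have tri: "d a b \<le> d a q + d b q" if "a \<in> X" "b \<in> X" for a b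
      using triangle[of a q b] commute[of q b] that assms(3) by simp
    note D = d'[OF Y(1,2)] d'[OF Y(3,4)] d'[OF Y(1,3)] d'[OF Y(2,4)] d'[OF Y(1,4)] d'[OF Y(2,3)]
    note T = tri[OF p[OF Y(1)] p[OF Y(2)]] tri[OF p[OF Y(1)] p[OF Y(3)]] tri[OF p[OF Y(1)] p[OF Y(4)]]
      tri[OF p[OF Y(2)] p[OF Y(3)]] tri[OF p[OF Y(2)] p[OF Y(4)]] tri[OF p[OF Y(3)] p[OF Y(4)]]
    note P = pt[OF Y(1)] pt[OF Y(2)] pt[OF Y(3)] pt[OF Y(4)]
    have qq: "d q q = 0" using assms(3) by simp
    \<comment> \<open>Each of the four points has height 0 or retracts to \<open>q\<close>. In all
      sixteen cases the claim is linear arithmetic from the condition in \<open>X\<close> and the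
      triangle inequalities through \<open>q\<close>.\<close>
    show ?thesis
      unfolding D using P H T t[OF Y(1)] t[OF Y(2)] t[OF Y(3)] t[OF Y(4)]
      by (elim disjE; simp add: qq; smt (verit) commute nonneg)
  qed
  then show ?thesis by (auto simp: zero_hyperbolic_on_def)
qed

text \<open>The induction carries along that the infimum of path lengths is attained: minimal paths
  of the new tree are built from those of the old one, and they become the geodesics. Hyperbolicity
  comes from an exact formula for the new metric, the distance of the retractions plus the
  difference of heights on the new edge.\<close>

lemma grown_tree_metric:
  assumes "grown_tree V E" "\<forall>e\<in>E. 0 < len e"
  shows "zero_hyperbolic_on (complex_points V E) (shortest_path_dist E len) \<and>
    (\<forall>x\<in>complex_points V E. \<forall>y\<in>complex_points V E.
       piecewise_path E len x y (shortest_path_dist E len x y))"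
  using assms
proof (induction rule: grown_tree.induct)
  case (singleton r)
  have "shortest_path_dist {} len (vertex r) (vertex r) = 0"
    using piecewise_path_nonneg[where E = "{}"]
    by (intro shortest_path_dist_eqI piecewise_path.refl) auto
  then show ?case
    by (auto simp: complex_points_def zero_hyperbolic_on_def intro: piecewise_path.refl)
next
  case (add_leaf V E u v)
  let ?X = "complex_points V E" and ?Y = "complex_points (insert v V) (insert {u, v} E)"
  let ?d = "shortest_path_dist E len" and ?d' = "shortest_path_dist (insert {u, v} E) len"
  let ?\<pi> = "collapse u v" and ?l = "len {u, v}"
  have uv: "u \<noteq> v" using add_leaf by blast
  have l: "0 < ?l" and lenE: "\<forall>e\<in>E. 0 < len e" "\<forall>e\<in>E. 0 \<le> len e"
    using add_leaf.prems by (auto intro: less_imp_le)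
  have G: "finite_connected_graph V E" and S: "finite_simple_graph V E"
    using grown_tree_connected grown_tree_simple_graph add_leaf.hyps by blast+
  interpret Metric_space ?X ?d by (rule Metric_space_complex[OF G lenE(1)])
  have uX: "vertex u \<in> ?X" using add_leaf.hyps by (auto simp: complex_points_def)
  note cases = complex_points_add_leaf[OF S add_leaf.hyps(2,3)]
  have \<pi>X: "?\<pi> x \<in> ?X" if "x \<in> ?Y" for x using cases[OF that] uX by auto
  have to_\<pi>: "piecewise_path (insert {u, v} E) len x (?\<pi> x) (?l * x v)" if "x \<in> ?Y" for x
    using cases[OF that]
  proof (elim disjE conjE)
    assume x: "x \<in> edge_points {u, v}" "?\<pi> x = vertex u"
    have "vertex u \<in> edge_points {u, v}" using uv by (auto intro!: vertex_in_edge_points)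
    with x piecewise_path_edge[of "{u, v}" "insert {u, v} E" x "vertex u" len] uv show ?thesis
      by (simp add: edge_dist_doubleton edge_points_doubleton) (simp add: vertex_def)
  qed (simp add: piecewise_path.refl)
  have path: "piecewise_path (insert {u, v} E) len x y (?d (?\<pi> x) (?\<pi> y) + ?l * \<bar>x v - y v\<bar>)"
    if xy: "x \<in> ?Y" "y \<in> ?Y" for x y
  proof (cases "x \<in> edge_points {u, v} \<and> y \<in> edge_points {u, v}")
    case True
    then have "?\<pi> x = vertex u" "?\<pi> y = vertex u" using collapse_leaf_edge[OF uv] by auto
    with True piecewise_path_edge[of "{u, v}" "insert {u, v} E" x y len] uX show ?thesis
      using edge_dist_doubleton[OF uv] by simp
  next
    case False
    \<comment> \<open>One of the points lies in the old tree, so the difference of heights is their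
      sum, and the route through both retractions has the right length.\<close>
    then have "x v = 0 \<or> y v = 0" using cases[OF xy(1)] cases[OF xy(2)] by blast
    moreover have "0 \<le> x v" "0 \<le> y v" using xy complex_points_nonneg by metis+
    ultimately have *: "?l * x v + (?d (?\<pi> x) (?\<pi> y) + ?l * y v) =
        ?d (?\<pi> x) (?\<pi> y) + ?l * \<bar>x v - y v\<bar>"
      by (auto simp: algebra_simps)
    have "piecewise_path E len (?\<pi> x) (?\<pi> y) (?d (?\<pi> x) (?\<pi> y))"
      using add_leaf.IH[OF lenE(1)] \<pi>X[OF xy(1)] \<pi>X[OF xy(2)] by blast
    then have "piecewise_path (insert {u, v} E) len (?\<pi> x) (?\<pi> y) (?d (?\<pi> x) (?\<pi> y))"
      by (rule piecewise_path_mono) auto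
    from piecewise_path_append[OF to_\<pi>[OF xy(1)] piecewise_path_append[OF this
      piecewise_path_sym[OF to_\<pi>[OF xy(2)]]]]
    show ?thesis unfolding * .
  qed
  have d': "?d' x y = ?d (?\<pi> x) (?\<pi> y) + ?l * \<bar>x v - y v\<bar>"
    if xy: "x \<in> ?Y" "y \<in> ?Y" for x y
  proof (rule shortest_path_dist_eqI[OF path[OF xy]])
    fix K assume "piecewise_path (insert {u, v} E) len x y K"
    then obtain K' where "piecewise_path E len (?\<pi> x) (?\<pi> y) K'"
      "K' + ?l * \<bar>x v - y v\<bar> \<le> K"
      using piecewise_path_collapse[of u v E len x y K V] S add_leaf.hyps(2,3) l by blast
    then show "?d (?\<pi> x) (?\<pi> y) + ?l * \<bar>x v - y v\<bar> \<le> K"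
      using shortest_path_dist_le[OF _ lenE(2), of "?\<pi> x" "?\<pi> y" K'] by simp
  qed
  have "zero_hyperbolic_on ?Y ?d'"
  proof (rule zero_hyperbolic_on_glue[where p = ?\<pi> and t = "\<lambda>x. ?l * x v" and q = "vertex u"])
    show "Metric_space ?X ?d" by (rule Metric_space_axioms)
    show "zero_hyperbolic_on ?X ?d" using add_leaf.IH lenE by blast
    show "?l * x v = 0 \<or> ?\<pi> x = vertex u" if "x \<in> ?Y" for x
      using cases[OF that] by auto
    show "?d' x y = ?d (?\<pi> x) (?\<pi> y) + \<bar>?l * x v - ?l * y v\<bar>" if "x \<in> ?Y" "y \<in> ?Y" for x y
      using d'[OF that] l by (simp add: abs_mult right_diff_distrib[symmetric])
    show "0 \<le> ?l * x v" if "x \<in> ?Y" for x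
      using l complex_points_nonneg[OF that, of v] by simp
  qed (use uX \<pi>X in auto)
  moreover have "\<forall>x\<in>?Y. \<forall>y\<in>?Y. piecewise_path (insert {u, v} E) len x y (?d' x y)"
    using path d' by simp
  ultimately show ?case by (rule conjI)
qed

section \<open>Segments inside an edge\<close>

definition edge_segment :: "('v \<Rightarrow> real) \<Rightarrow> ('v \<Rightarrow> real) \<Rightarrow> real \<Rightarrow> 'v \<Rightarrow> real" where
  "edge_segment x y t = (\<lambda>v. (1 - t) * x v + t * y v)"

lemma edge_segment_0 [simp]: "edge_segment x y 0 = x"
  and edge_segment_1 [simp]: "edge_segment x y 1 = y"
  by (simp_all add: edge_segment_def)

lemma edge_segment_in_edge_points:
  assumes "x \<in> edge_points e" "y \<in> edge_points e" "t \<in> {0..1}"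
  shows "edge_segment x y t \<in> edge_points e"
  using assms
  by (auto simp: edge_points_def edge_segment_def sum.distrib sum_distrib_left[symmetric])

lemma edge_dist_edge_segment:
  "edge_dist l e (edge_segment x y s) (edge_segment x y t) = \<bar>s - t\<bar> * edge_dist l e x y"
proof -
  have "\<bar>edge_segment x y s v - edge_segment x y t v\<bar> = \<bar>s - t\<bar> * \<bar>x v - y v\<bar>" for v
  proof -
    have "edge_segment x y s v - edge_segment x y t v = (s - t) * (y v - x v)"
      by (simp add: edge_segment_def algebra_simps)
    then show ?thesis by (simp add: abs_mult abs_minus_commute)
  qed
  then show ?thesis by (simp add: edge_dist_def sum_distrib_left[symmetric])
qed

lemma shortest_path_dist_edge_le:
  assumes "e \<in> E" "x \<in> edge_points e" "y \<in> edge_points e" "\<forall>e\<in>E. 0 \<le> len e"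
  shows "shortest_path_dist E len x y \<le> edge_dist (len e) e x y"
  using shortest_path_dist_le[OF piecewise_path_edge[OF assms(1-3)] assms(4)] .

text \<open>An arbitrary path need not be shortest, so arc length gives only a 1-Lipschitz curve;
  for a minimal path the triangle inequality turns this into an isometry.\<close>

lemma piecewise_path_parametrization:
  assumes "piecewise_path E len x y L" "x \<in> complex_points V E"
    and G: "finite_connected_graph V E" and len: "\<forall>e\<in>E. 0 < len e"
  shows "\<exists>\<gamma>. \<gamma> 0 = x \<and> \<gamma> L = y \<and> \<gamma> ` {0..L} \<subseteq> complex_points V E \<and>
    (\<forall>s\<in>{0..L}. \<forall>t\<in>{0..L}. shortest_path_dist E len (\<gamma> s) (\<gamma> t) \<le> \<bar>s - t\<bar>)"
  using assms(1,2)
proof induction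
  case (refl x)
  have "shortest_path_dist E len x x = 0"
    using Metric_space.mdist_zero[OF Metric_space_complex[OF G len] refl] .
  with refl show ?case by (intro exI[of _ "\<lambda>_. x"]) auto
next
  case (step e x y z L)
  let ?d = "shortest_path_dist E len" and ?l = "edge_dist (len e) e x y"
  interpret Metric_space "complex_points V E" ?d by (rule Metric_space_complex[OF G len])
  have len': "\<forall>e\<in>E. 0 \<le> len e" using len by (auto intro: less_imp_le)
  have X: "edge_points e \<subseteq> complex_points V E"
    using step.hyps by (auto simp: complex_points_def)
  have "y \<in> complex_points V E" using X step.hyps by blast
  from step.IH[OF this] obtain \<gamma> where "\<gamma> 0 = y" "\<gamma> L = z"
    "\<gamma> ` {0..L} \<subseteq> complex_points V E"
    "\<forall>s\<in>{0..L}. \<forall>t\<in>{0..L}. ?d (\<gamma> s) (\<gamma> t) \<le> \<bar>s - t\<bar>"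
    by (elim exE conjE)
  then have \<gamma>: "\<gamma> 0 = y" "\<gamma> L = z" "\<And>t. t \<in> {0..L} \<Longrightarrow> \<gamma> t \<in> complex_points V E"
    "\<And>s t. s \<in> {0..L} \<Longrightarrow> t \<in> {0..L} \<Longrightarrow> ?d (\<gamma> s) (\<gamma> t) \<le> \<bar>s - t\<bar>"
    by blast+
  have "0 \<le> L" using piecewise_path_nonneg[OF step.hyps(4) len'] .
  have "0 \<le> ?l" using len' step.hyps by (auto intro: edge_dist_nonneg)
  then consider "?l = 0" | "0 < ?l" by linarith
  then show ?case
  proof cases
    \<comment> \<open>Division by the length of the segment is impossible here, but the segment is
      then a single point and is dropped.\<close>
    case 1
    then have "?d x y \<le> 0" using shortest_path_dist_edge_le[OF step.hyps(1-3) len'] by simp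
    then have "x = y" using step.hyps X nonneg[of x y] zero[of x y] by auto
    with 1 \<gamma> show ?thesis by (intro exI[of _ \<gamma>]) auto
  next
    case 2
    define \<sigma> where "\<sigma> t = edge_segment x y (t / ?l)" for t
    have \<sigma>: "\<sigma> 0 = x" "\<sigma> ?l = y" using 2 by (auto simp: \<sigma>_def)
    have \<sigma>e: "\<sigma> t \<in> edge_points e" if "t \<in> {0..?l}" for t
      unfolding \<sigma>_def using step.hyps 2 that by (intro edge_segment_in_edge_points) auto
    have \<sigma>d: "?d (\<sigma> s) (\<sigma> t) \<le> \<bar>s - t\<bar>" if "s \<in> {0..?l}" "t \<in> {0..?l}" for s t
    proof -
      have "?d (\<sigma> s) (\<sigma> t) \<le> edge_dist (len e) e (\<sigma> s) (\<sigma> t)"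
        using \<sigma>e that step.hyps len' by (intro shortest_path_dist_edge_le) auto
      also have "\<dots> = \<bar>s / ?l - t / ?l\<bar> * ?l"
        by (simp add: \<sigma>_def edge_dist_edge_segment)
      also have "\<dots> = \<bar>s - t\<bar>" using 2 by (simp add: diff_divide_distrib[symmetric] abs_divide)
      finally show ?thesis .
    qed
    define \<beta> where "\<beta> t = (if t \<le> ?l then \<sigma> t else \<gamma> (t - ?l))" for t
    have \<beta>X: "\<beta> t \<in> complex_points V E" if "t \<in> {0..?l + L}" for t
      using that X \<sigma>e \<gamma>(3) by (auto simp: \<beta>_def)
    have *: "?d (\<beta> s) (\<beta> t) \<le> t - s" if "0 \<le> s" "s \<le> t" "t \<le> ?l + L" for s t
    proof -
      consider "t \<le> ?l" | "?l < s" | "s \<le> ?l" "?l < t" by linarith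
      then show ?thesis
      proof cases
        case 1
        then show ?thesis using that \<sigma>d[of s t] by (auto simp: \<beta>_def)
      next
        case 2
        then show ?thesis using that \<gamma>(4)[of "s - ?l" "t - ?l"] by (auto simp: \<beta>_def)
      next
        case 3
        have "?d (\<sigma> s) (\<gamma> (t - ?l)) \<le> ?d (\<sigma> s) y + ?d y (\<gamma> (t - ?l))"
          using 3 that X \<sigma>e[of s] \<gamma>(3)[of "t - ?l"] step.hyps by (intro triangle) auto
        also have "\<dots> \<le> (?l - s) + (t - ?l)"
          using 3 that \<sigma>d[of s ?l] \<gamma>(4)[of 0 "t - ?l"] \<open>0 \<le> L\<close> \<sigma> \<gamma>(1) by (intro add_mono) auto
        finally show ?thesis using 3 by (simp add: \<beta>_def)
      qed
    qed
    have "?d (\<beta> s) (\<beta> t) \<le> \<bar>s - t\<bar>" if "s \<in> {0..?l + L}" "t \<in> {0..?l + L}" for s t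
      using *[of s t] *[of t s] commute that by (cases "s \<le> t") auto
    moreover have "\<beta> 0 = x" using 2 \<sigma> by (simp add: \<beta>_def)
    moreover have "\<beta> (?l + L) = z"
      using \<sigma> \<gamma>(1,2) \<open>0 \<le> L\<close> by (cases "L = 0") (auto simp: \<beta>_def)
    ultimately show ?thesis using \<beta>X by (intro exI[of _ \<beta>] conjI ballI image_subsetI) simp_all
  qed
qed

section \<open>Maps into real trees\<close>

text \<open>Geodesic spaces with the four-point condition are the real trees. The analysis below
  sees \<open>T\<close> only through these two properties.\<close>

locale real_tree =
  fixes T :: "'z metric"
  assumes geodesic: "\<lbrakk>a \<in> mspace T; b \<in> mspace T\<rbrakk> \<Longrightarrow> \<exists>S. geodesic_segment T a b S"
    and hyperbolic: "zero_hyperbolic_on (mspace T) (mdist T)"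

lemma metric_tree_real_tree:
  assumes "metric_tree T"
  shows "real_tree T"
proof -
  obtain V E len where tree: "finite_tree V E" and len: "\<forall>e\<in>E. 0 < len e"
    and T: "T = metric_complex V E len"
    using assms by (auto simp: metric_tree_def)
  let ?X = "complex_points V E" and ?d = "shortest_path_dist E len"
  have gt: "grown_tree V E" by (rule grown_tree_if_finite_tree[OF tree])
  have G: "finite_connected_graph V E" using tree by (simp add: finite_tree_def)
  interpret Metric_space ?X ?d by (rule Metric_space_complex[OF G len])
  have X: "mspace T = ?X" and d: "mdist T = ?d"
    unfolding T using mspace_metric_complex[OF G len] mdist_metric_complex[OF G len] .
  show ?thesis
  proof
    show "zero_hyperbolic_on (mspace T) (mdist T)"
      unfolding X d using grown_tree_metric[OF gt len] by blast
    fix a b assume "a \<in> mspace T" "b \<in> mspace T"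
    then have ab: "a \<in> ?X" "b \<in> ?X" by (simp_all add: X)
    let ?L = "?d a b"
    have "piecewise_path E len a b ?L" using grown_tree_metric[OF gt len] ab by blast
    from piecewise_path_parametrization[OF this ab(1) G len]
    obtain \<gamma> where \<gamma>: "\<gamma> 0 = a" "\<gamma> ?L = b" "\<gamma> ` {0..?L} \<subseteq> ?X"
      and "\<forall>s\<in>{0..?L}. \<forall>t\<in>{0..?L}. ?d (\<gamma> s) (\<gamma> t) \<le> \<bar>s - t\<bar>"
      by (elim exE conjE)
    then have \<gamma>d: "\<And>s t. s \<in> {0..?L} \<Longrightarrow> t \<in> {0..?L} \<Longrightarrow> ?d (\<gamma> s) (\<gamma> t) \<le> \<bar>s - t\<bar>"
      by blast
    \<comment> \<open>The 1-Lipschitz bounds on \<open>[0, s]\<close>, \<open>[s, t]\<close> and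
      \<open>[t, ?L]\<close> add up to the distance \<open>?L\<close> of the ends, so each of them
      is an equality.\<close>
    have *: "?d (\<gamma> s) (\<gamma> t) = t - s" if "0 \<le> s" "s \<le> t" "t \<le> ?L" for s t
    proof -
      have st: "s \<in> {0..?L}" "t \<in> {0..?L}" "0 \<in> {0..?L}" "?L \<in> {0..?L}" using that by auto
      then have "\<gamma> s \<in> ?X" "\<gamma> t \<in> ?X" using \<gamma>(3) by blast+
      then have "?L \<le> ?d a (\<gamma> s) + ?d (\<gamma> s) (\<gamma> t) + ?d (\<gamma> t) b"
        using triangle[of a "\<gamma> s" b] triangle[of "\<gamma> s" "\<gamma> t" b] ab by linarith
      then show ?thesis
        using \<gamma>d[OF st(3,1)] \<gamma>d[OF st(1,2)] \<gamma>d[OF st(2,4)] \<gamma>(1,2) that by simp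
    qed
    have "?d (\<gamma> s) (\<gamma> t) = \<bar>s - t\<bar>" if "s \<in> {0..?L}" "t \<in> {0..?L}" for s t
      using *[of s t] *[of t s] commute that by (cases "s \<le> t") auto
    then have "geodesic_segment T a b (\<gamma> ` {0..?L})"
      unfolding geodesic_segment_def X d using \<gamma>(1-3) by (intro exI[of _ \<gamma>]) auto
    then show "\<exists>S. geodesic_segment T a b S" by blast
  qed
qed

section \<open>Geodesic segments and metric betweenness\<close>

lemma geodesic_segmentE:
  assumes "geodesic_segment Z a b S"
  obtains \<gamma> where "\<gamma> 0 = a" "\<gamma> (mdist Z a b) = b" "S = \<gamma> ` {0..mdist Z a b}"
    "\<gamma> \<in> {0..mdist Z a b} \<rightarrow> mspace Z"
    "\<forall>s\<in>{0..mdist Z a b}. \<forall>t\<in>{0..mdist Z a b}. mdist Z (\<gamma> s) (\<gamma> t) = \<bar>s - t\<bar>"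
  using assms unfolding geodesic_segment_def by (elim exE conjE)

lemma geodesic_segment_endpoints:
  assumes "geodesic_segment Z a b S"
  shows "a \<in> S" "b \<in> S"
proof -
  obtain \<gamma> where "\<gamma> 0 = a" "\<gamma> (mdist Z a b) = b" "S = \<gamma> ` {0..mdist Z a b}"
    using assms by (rule geodesic_segmentE)
  moreover have "0 \<in> {0..mdist Z a b}" "mdist Z a b \<in> {0..mdist Z a b}" by simp_all
  ultimately show "a \<in> S" "b \<in> S" by (metis imageI)+
qed

lemma geodesic_segment_subset:
  assumes "geodesic_segment Z a b S"
  shows "S \<subseteq> mspace Z"
  using assms by (rule geodesic_segmentE) auto

lemma geodesic_segment_commute:
  assumes "geodesic_segment Z a b S"
  shows "geodesic_segment Z b a S"
proof -
  let ?D = "mdist Z a b"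
  obtain \<gamma> where \<gamma>: "\<gamma> 0 = a" "\<gamma> ?D = b" "S = \<gamma> ` {0..?D}" "\<gamma> \<in> {0..?D} \<rightarrow> mspace Z"
    "\<forall>s\<in>{0..?D}. \<forall>t\<in>{0..?D}. mdist Z (\<gamma> s) (\<gamma> t) = \<bar>s - t\<bar>"
    using assms by (rule geodesic_segmentE)
  have D: "mdist Z b a = ?D" by (rule mdist_commute)
  have "S = (\<lambda>t. \<gamma> (?D - t)) ` {0..?D}"
    unfolding \<gamma>(3)
  proof (intro equalityI subsetI)
    fix p assume "p \<in> \<gamma> ` {0..?D}"
    then obtain t where "t \<in> {0..?D}" "p = \<gamma> t" by blast
    then show "p \<in> (\<lambda>t. \<gamma> (?D - t)) ` {0..?D}" by (intro image_eqI[of _ _ "?D - t"]) auto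
  qed auto
  then show ?thesis
    unfolding geodesic_segment_def D using \<gamma>(1,2,4,5) by (intro exI[of _ "\<lambda>t. \<gamma> (?D - t)"]) auto
qed

text \<open>Degenerate triples count as well, which is why prolonging a chain in
  \<open>between_extend\<close> asks for \<open>y \<noteq> z\<close>.\<close>

definition between :: "'z metric \<Rightarrow> 'z \<Rightarrow> 'z \<Rightarrow> 'z \<Rightarrow> bool" where
  "between Z a b c \<longleftrightarrow> mdist Z a c = mdist Z a b + mdist Z b c"

lemma between_commute: "between Z a b c \<Longrightarrow> between Z c b a"
  by (simp add: between_def mdist_commute)

lemma mdist_self [simp]: "a \<in> mspace Z \<Longrightarrow> mdist Z a a = 0"
  by simp

text \<open>The triangle inequality alone forces the order \<open>a, b, c, e\<close>, here and in
  the mirror image that follows; \<open>between_extend\<close>, by contrast, is special to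
  trees.\<close>

lemma between_inner_left:
  assumes "a \<in> mspace Z" "b \<in> mspace Z" "c \<in> mspace Z" "e \<in> mspace Z"
    and "between Z a b e" "between Z b c e"
  shows "between Z a b c" "between Z a c e"
  using assms(5,6) mdist_triangle[OF assms(1,3,4)] mdist_triangle[OF assms(1,2,3)]
  unfolding between_def by linarith+

lemma between_inner_right:
  assumes "a \<in> mspace Z" "b \<in> mspace Z" "c \<in> mspace Z" "e \<in> mspace Z"
    and "between Z a c e" "between Z a b c"
  shows "between Z a b e" "between Z b c e"
  using assms(5,6) mdist_triangle[OF assms(1,2,4)] mdist_triangle[OF assms(2,3,4)]
  unfolding between_def by linarith+

section \<open>Consequences of the four-point condition\<close>

context real_tree
begin

lemma four_point:
  assumes "x \<in> mspace T" "y \<in> mspace T" "z \<in> mspace T" "w \<in> mspace T"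
  shows "mdist T x y + mdist T z w \<le>
    max (mdist T x z + mdist T y w) (mdist T x w + mdist T y z)"
  using hyperbolic assms by (auto simp: zero_hyperbolic_on_def)

text \<open>In the four-point condition for \<open>p, q, a, b\<close> both competing sums equal
  \<open>mdist T a b\<close>, which leaves no room for a distance between \<open>p\<close> and
  \<open>q\<close>.\<close>

lemma between_unique:
  assumes "a \<in> mspace T" "b \<in> mspace T" "p \<in> mspace T" "q \<in> mspace T"
    and "between T a p b" "mdist T q a = mdist T p a" "mdist T q b = mdist T p b"
  shows "p = q"
proof -
  have "mdist T p q + mdist T a b \<le> mdist T a b"
    using four_point[OF assms(3,4,1,2)] assms(5-7) by (simp add: between_def mdist_commute)
  then have "mdist T p q = 0" using mdist_nonneg[of T p q] by linarith
  then show ?thesis using assms(3,4) by simp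
qed

text \<open>In a tree, local geodesics are geodesics.\<close>

lemma between_extend:
  assumes "x \<in> mspace T" "y \<in> mspace T" "z \<in> mspace T" "w \<in> mspace T"
    and "between T x y z" "between T y z w" "y \<noteq> z"
  shows "between T x z w" "between T x y w"
proof -
  have "0 < mdist T y z" using assms mdist_zero[of y T z] mdist_nonneg[of T y z] by linarith
  \<comment> \<open>As \<open>y \<noteq> z\<close>, the sum \<open>mdist T x z + mdist T y w\<close>
    exceeds \<open>mdist T x y + mdist T z w\<close>, so the other term of the four-point maximum
    must dominate it.\<close>
  then have "mdist T x z + mdist T z w \<le> mdist T x w"
    using four_point[OF assms(1,3,2,4)] assms(5,6)
    by (simp add: between_def mdist_commute[of T z y])
  then show "between T x z w"
    using mdist_triangle[OF assms(1,3,4)] by (simp add: between_def)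
  then show "between T x y w" using assms(5,6) by (simp add: between_def)
qed

text \<open>Which alternative holds is decided by the larger term of the four-point maximum for
  \<open>u, w, a, p\<close>.\<close>

lemma between_one_of_two_directions:
  assumes "a \<in> mspace T" "p \<in> mspace T" "u \<in> mspace T" "w \<in> mspace T"
    and "between T u p w" "mdist T u p = mdist T w p"
  shows "between T a p u \<or> between T a p w"
proof -
  have "mdist T a p + mdist T p u \<le> mdist T a u \<or> mdist T a p + mdist T p w \<le> mdist T a w"
    using four_point[OF assms(3,4,1,2)] assms(5,6) mdist_commute[of T u a] mdist_commute[of T w a]
      mdist_commute[of T u p] mdist_commute[of T w p]
    unfolding between_def by linarith
  then show ?thesis
    using mdist_triangle[OF assms(1,2,3)] mdist_triangle[OF assms(1,2,4)]
    by (auto simp: between_def)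
qed

end

section \<open>Linear interpolation\<close>

lemma edge_points_vertex_iff:
  assumes "u \<noteq> v"
  shows "vertex w \<in> edge_points {u, v} \<longleftrightarrow> w = u \<or> w = v"
  using assms by (auto simp: edge_points_doubleton vertex_def)

lemma edge_points_eq_vertex:
  assumes "u \<noteq> v" "x \<in> edge_points {u, v}" "x u = 0"
  shows "x = vertex v"
  using assms by (intro ext) (auto simp: edge_points_doubleton vertex_def)

lemma edge_dist_vertex:
  assumes "u \<noteq> v" "x \<in> edge_points {u, v}"
  shows "edge_dist 1 {u, v} x (vertex u) = x v" "edge_dist 1 {u, v} x (vertex v) = x u"
proof -
  have "vertex u \<in> edge_points {u, v}" "vertex v \<in> edge_points {u, v}"
    using assms(1) by (auto simp: edge_points_vertex_iff)
  then show "edge_dist 1 {u, v} x (vertex u) = x v" "edge_dist 1 {u, v} x (vertex v) = x u"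
    using assms edge_dist_doubleton[OF assms]
    by (auto simp: edge_points_doubleton vertex_def)
qed

locale graph_map = real_tree T for T :: "'z metric" +
  fixes V :: "'v set" and E :: "'v set set" and f :: "'v \<Rightarrow> 'z"
  assumes connected: "finite_connected_graph V E"
    and f: "f \<in> V \<rightarrow> mspace T"
begin

abbreviation "X \<equiv> complex_points V E"
abbreviation "d \<equiv> shortest_path_dist E (\<lambda>e. 1)"
abbreviation "F \<equiv> linear_interpolation V E T f"

sublocale X: Metric_space X d
  by (rule Metric_space_complex[OF connected]) simp

lemma mspace_unit_complex: "mspace (unit_complex V E) = X"
  and mdist_unit_complex: "mdist (unit_complex V E) = d"
  unfolding unit_complex_def
  using mspace_metric_complex[OF connected, of "\<lambda>e. 1"] mdist_metric_complex[OF connected, of "\<lambda>e. 1"]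
  by auto

lemma finite_V: "finite V"
  using connected by (simp add: finite_connected_graph_def finite_simple_graph_def)

lemma f_in [simp]: "v \<in> V \<Longrightarrow> f v \<in> mspace T"
  using f by blast

lemma geodesic_f: "\<lbrakk>u \<in> V; v \<in> V\<rbrakk> \<Longrightarrow> \<exists>S. geodesic_segment T (f u) (f v) S"
  by (intro geodesic) simp_all

lemma edgeD:
  assumes "{u, v} \<in> E"
  shows "u \<noteq> v" "u \<in> V" "v \<in> V"
  using connected assms
  by (fastforce simp: finite_connected_graph_def finite_simple_graph_def)+

lemma edgeE:
  assumes "e \<in> E"
  obtains u v where "e = {u, v}"
  using connected assms
  by (fastforce simp: finite_connected_graph_def finite_simple_graph_def card_2_iff)

lemma vertex_in_X: "v \<in> V \<Longrightarrow> vertex v \<in> X"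
  by (auto simp: complex_points_def)

lemma edge_points_subset_X: "e \<in> E \<Longrightarrow> edge_points e \<subseteq> X"
  by (auto simp: complex_points_def)

lemma piecewise_path_in_X:
  assumes "piecewise_path E len x y L" "x \<in> X"
  shows "y \<in> X"
  using assms
proof induction
  case (step e x y z L)
  then show ?case using edge_points_subset_X by blast
qed

lemma vertex_in_edge:
  assumes "{u, v} \<in> E"
  shows "vertex u \<in> edge_points {u, v}" "vertex v \<in> edge_points {u, v}"
  using edge_points_vertex_iff[OF edgeD(1)[OF assms]] by auto

text \<open>The condition under the description in \<open>linear_interpolation\<close>, with
  \<open>r\<close> eliminated. The coordinates cross over: \<open>x v\<close> is the distance of
  \<open>x\<close> from the vertex \<open>u\<close>.\<close>

definition interpolates :: "('v \<Rightarrow> real) \<Rightarrow> 'z \<Rightarrow> bool" where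
  "interpolates x p \<longleftrightarrow> (\<forall>v\<in>V. x = vertex v \<longrightarrow> p = f v) \<and>
     (\<forall>u v. {u, v} \<in> E \<and> x \<in> edge_points {u, v} \<longrightarrow>
        (\<exists>S. geodesic_segment T (f u) (f v) S \<and> p \<in> S) \<and>
        mdist T p (f u) = x v * mdist T (f u) (f v) \<and>
        mdist T p (f v) = x u * mdist T (f u) (f v))"

lemma linear_interpolation_eq: "F x = (THE p. interpolates x p)"
proof -
  have *: "edge_dist 1 {u, v} x (vertex u) = x v" "edge_dist 1 {u, v} x (vertex v) = x u" "1 - x v = x u"
    if "{u, v} \<in> E" "x \<in> edge_points {u, v}" for u v
    using edge_dist_vertex[OF edgeD(1)[OF that(1)] that(2)] that(2)
      edge_points_doubleton[OF edgeD(1)[OF that(1)], of x] by auto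
  have "(\<forall>u v r. {u, v} \<in> E \<and> x \<in> edge_points {u, v} \<and>
            edge_dist 1 {u, v} x (vertex u) = r \<and> edge_dist 1 {u, v} x (vertex v) = 1 - r \<longrightarrow>
          (\<exists>S. geodesic_segment T (f u) (f v) S \<and> p \<in> S) \<and>
          mdist T p (f u) = r * mdist T (f u) (f v) \<and>
          mdist T p (f v) = (1 - r) * mdist T (f u) (f v)) \<longleftrightarrow>
      (\<forall>u v. {u, v} \<in> E \<and> x \<in> edge_points {u, v} \<longrightarrow>
        (\<exists>S. geodesic_segment T (f u) (f v) S \<and> p \<in> S) \<and>
        mdist T p (f u) = x v * mdist T (f u) (f v) \<and>
        mdist T p (f v) = x u * mdist T (f u) (f v))" (is "?L p \<longleftrightarrow> ?R p") for p
  proof (intro iffI allI impI)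
    fix u v assume L: "?L p" and uv: "{u, v} \<in> E \<and> x \<in> edge_points {u, v}"
    note s = *[OF conjunct1[OF uv] conjunct2[OF uv]]
    from L[rule_format, of u v "x v"] uv s
    show "(\<exists>S. geodesic_segment T (f u) (f v) S \<and> p \<in> S) \<and>
        mdist T p (f u) = x v * mdist T (f u) (f v) \<and>
        mdist T p (f v) = x u * mdist T (f u) (f v)" by simp
  next
    fix u v r assume R: "?R p" and uv: "{u, v} \<in> E \<and> x \<in> edge_points {u, v} \<and>
            edge_dist 1 {u, v} x (vertex u) = r \<and> edge_dist 1 {u, v} x (vertex v) = 1 - r"
    then have "r = x v" "1 - r = x u" using *[of u v] by auto
    with R[rule_format, of u v] uv
    show "(\<exists>S. geodesic_segment T (f u) (f v) S \<and> p \<in> S) \<and>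
          mdist T p (f u) = r * mdist T (f u) (f v) \<and>
          mdist T p (f v) = (1 - r) * mdist T (f u) (f v)" by simp
  qed
  then show ?thesis unfolding linear_interpolation_def interpolates_def by simp
qed

text \<open>A vertex belongs to all edges at it, so well-definedness here means that the clauses of
  these edges agree on one value.\<close>

lemma interpolates_vertex:
  assumes "v \<in> V"
  shows "interpolates (vertex v) p \<longleftrightarrow> p = f v"
proof
  assume "p = f v"
  have "(\<exists>S. geodesic_segment T (f a) (f b) S \<and> f v \<in> S) \<and>
        mdist T (f v) (f a) = vertex v b * mdist T (f a) (f b) \<and>
        mdist T (f v) (f b) = vertex v a * mdist T (f a) (f b)"
    if "{a, b} \<in> E" "vertex v \<in> edge_points {a, b}" for a b
  proof -
    note ab = edgeD[OF that(1)]
    obtain S where S: "geodesic_segment T (f a) (f b) S" using geodesic_f[OF ab(2,3)] by blast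
    have "v = a \<or> v = b" using that(2) edge_points_vertex_iff[OF ab(1)] by blast
    then show ?thesis
      using S geodesic_segment_endpoints[OF S] ab by (auto simp: vertex_def mdist_commute)
  qed
  then show "interpolates (vertex v) p"
    unfolding interpolates_def \<open>p = f v\<close> using inj_vertex by (auto dest: injD)
qed (use assms in \<open>auto simp: interpolates_def\<close>)

lemma interpolates_unique:
  assumes "x \<in> X" "interpolates x p" "interpolates x q"
  shows "p = q"
proof (cases "x \<in> vertex ` V")
  case True
  then show ?thesis using assms(2,3) interpolates_vertex by auto
next
  case False
  then obtain e where "e \<in> E" "x \<in> edge_points e" using assms(1) by (auto simp: complex_points_def)
  then obtain u v where uv: "{u, v} \<in> E" "x \<in> edge_points {u, v}" by (metis edgeE)
  have 1: "x u + x v = 1" using uv(2) edgeD[OF uv(1)] by (auto simp: edge_points_doubleton)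
  have *: "r \<in> mspace T \<and> mdist T r (f u) = x v * mdist T (f u) (f v) \<and>
      mdist T r (f v) = x u * mdist T (f u) (f v)" if "interpolates x r" for r
    using that[unfolded interpolates_def, THEN conjunct2, rule_format, of u v] uv
      geodesic_segment_subset[of T "f u" "f v"] by blast
  show ?thesis
  proof (rule between_unique[of "f u" "f v"])
    have "mdist T (f u) (f v) = (x v + x u) * mdist T (f u) (f v)" using 1 by (simp add: add.commute)
    then show "between T (f u) p (f v)"
      using *[OF assms(2)] by (simp add: between_def mdist_commute[of T "f u" p] distrib_right)
  qed (use *[OF assms(2)] *[OF assms(3)] edgeD[OF uv(1)] in auto)
qed

lemma interpolates_exists:
  assumes "x \<in> X"
  shows "\<exists>p. interpolates x p"
proof (cases "x \<in> vertex ` V")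
  case True
  then show ?thesis using interpolates_vertex by auto
next
  case False
  then obtain e where "e \<in> E" "x \<in> edge_points e" using assms(1) by (auto simp: complex_points_def)
  then obtain u v where uv: "{u, v} \<in> E" "x \<in> edge_points {u, v}" by (metis edgeE)
  note uv' = edgeD[OF uv(1)]
  let ?D = "mdist T (f u) (f v)"
  have x: "0 \<le> x u" "0 \<le> x v" "x u + x v = 1" using uv(2) uv'(1) by (auto simp: edge_points_doubleton)
  obtain S where S: "geodesic_segment T (f u) (f v) S" using geodesic_f[OF uv'(2,3)] by blast
  then obtain \<gamma> where \<gamma>: "\<gamma> 0 = f u" "\<gamma> ?D = f v" "S = \<gamma> ` {0..?D}"
    "\<forall>s\<in>{0..?D}. \<forall>t\<in>{0..?D}. mdist T (\<gamma> s) (\<gamma> t) = \<bar>s - t\<bar>"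
    by (rule geodesic_segmentE)
  define s where "s = x v * ?D"
  have s: "s \<in> {0..?D}" unfolding s_def using x by (auto intro: mult_left_le_one_le)
  have sD: "0 \<in> {0..?D}" "?D \<in> {0..?D}" by auto
  have "x u = 1 - x v" using x(3) by simp
  then have xu: "x u * ?D = ?D - s" by (simp add: s_def left_diff_distrib)
  have dist: "mdist T (\<gamma> s) (f u) = x v * ?D" "mdist T (\<gamma> s) (f v) = x u * ?D"
    using \<gamma>(4)[rule_format, OF s sD(1)] \<gamma>(4)[rule_format, OF s sD(2)] \<gamma>(1,2) s xu
    by (auto simp: s_def)
  \<comment> \<open>A point that is no vertex has exactly two nonzero coordinates and so determines
    its edge; only the two orientations remain.\<close>
  have "{a, b} = {u, v}" if "{a, b} \<in> E" "x \<in> edge_points {a, b}" for a b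
  proof -
    have "x u \<noteq> 0" "x v \<noteq> 0"
      using False edge_points_eq_vertex[OF uv'(1) uv(2)] uv'(2,3)
        edge_points_eq_vertex[OF uv'(1)[symmetric], of x] uv(2) by (auto simp: insert_commute)
    then have "u \<in> {a, b}" "v \<in> {a, b}" using that(2) unfolding edge_points_def by blast+
    then show ?thesis using uv'(1) by auto
  qed
  then have "a = u \<and> b = v \<or> a = v \<and> b = u" if "{a, b} \<in> E" "x \<in> edge_points {a, b}" for a b
    using that by (auto simp: doubleton_eq_iff)
  moreover have "\<gamma> s \<in> S" using \<gamma>(3) s by blast
  ultimately have *: "(\<exists>S. geodesic_segment T (f a) (f b) S \<and> \<gamma> s \<in> S) \<and>
      mdist T (\<gamma> s) (f a) = x b * mdist T (f a) (f b) \<and>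
      mdist T (\<gamma> s) (f b) = x a * mdist T (f a) (f b)"
    if "{a, b} \<in> E" "x \<in> edge_points {a, b}" for a b
    using that S geodesic_segment_commute[OF S] dist mdist_commute[of T "f v" "f u"] by metis
  have "interpolates x (\<gamma> s)"
    unfolding interpolates_def
  proof (intro conjI[OF _ allI[OF allI[OF impI]]])
    show "\<forall>v\<in>V. x = vertex v \<longrightarrow> \<gamma> s = f v" using False by auto
  qed (elim conjE, rule *)
  then show ?thesis by blast
qed

lemma interpolates_F:
  assumes "x \<in> X"
  shows "interpolates x (F x)"
  unfolding linear_interpolation_eq
  using interpolates_exists[OF assms] interpolates_unique[OF assms] by (metis theI)

lemma F_vertex: "v \<in> V \<Longrightarrow> F (vertex v) = f v"
  using interpolates_F[OF vertex_in_X] interpolates_vertex by blast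

lemma F_edge_vertex:
  assumes "{u, v} \<in> E" "x \<in> edge_points {u, v}"
  shows "mdist T (F x) (f u) = x v * mdist T (f u) (f v)"
    and "mdist T (F x) (f v) = x u * mdist T (f u) (f v)"
  using interpolates_F[of x] edge_points_subset_X[OF assms(1)] assms
  unfolding interpolates_def by blast+

lemma F_in_T:
  assumes "x \<in> X"
  shows "F x \<in> mspace T"
proof (cases "x \<in> vertex ` V")
  case True
  then show ?thesis using F_vertex by auto
next
  case False
  then obtain e where "e \<in> E" "x \<in> edge_points e" using assms by (auto simp: complex_points_def)
  then obtain u v where uv: "{u, v} \<in> E" "x \<in> edge_points {u, v}" by (metis edgeE)
  show ?thesis
    using interpolates_F[OF assms, unfolded interpolates_def, THEN conjunct2, rule_format, of u v] uv
      geodesic_segment_subset[of T "f u" "f v"] by blast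
qed

text \<open>\<open>between_unique\<close> identifies \<open>F\<close> on the edge with a geodesic
  from \<open>f u\<close> to \<open>f v\<close> run at constant speed, so
  \<open>mdist T (f u) (f v)\<close> is the slope of the edge.\<close>

lemma F_edge:
  assumes "{u, v} \<in> E" "x \<in> edge_points {u, v}" "y \<in> edge_points {u, v}"
  shows "mdist T (F x) (F y) = \<bar>x v - y v\<bar> * mdist T (f u) (f v)"
proof -
  let ?D = "mdist T (f u) (f v)"
  note uv = edgeD[OF assms(1)]
  obtain S where S: "geodesic_segment T (f u) (f v) S" using geodesic_f[OF uv(2,3)] by blast
  then obtain \<gamma> where \<gamma>: "\<gamma> 0 = f u" "\<gamma> ?D = f v" "\<gamma> \<in> {0..?D} \<rightarrow> mspace T"
    "\<forall>s\<in>{0..?D}. \<forall>t\<in>{0..?D}. mdist T (\<gamma> s) (\<gamma> t) = \<bar>s - t\<bar>"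
    by (rule geodesic_segmentE)
  have sD: "0 \<in> {0..?D}" "?D \<in> {0..?D}" by auto
  have in_D: "z v * ?D \<in> {0..?D}" and F: "F z = \<gamma> (z v * ?D)" if z: "z \<in> edge_points {u, v}" for z
  proof -
    have z': "0 \<le> z u" "0 \<le> z v" "z u = 1 - z v" using z uv(1) by (auto simp: edge_points_doubleton)
    then show s: "z v * ?D \<in> {0..?D}" by (auto intro: mult_left_le_one_le)
    note Fz = F_edge_vertex[OF assms(1) z]
    show "F z = \<gamma> (z v * ?D)"
    proof (rule between_unique[of "f u" "f v"])
      show "F z \<in> mspace T" using F_in_T edge_points_subset_X[OF assms(1)] z by blast
      show "between T (f u) (F z) (f v)"
        unfolding between_def using Fz z'(3) by (simp add: mdist_commute[of T "f u" "F z"] algebra_simps)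
      show "mdist T (\<gamma> (z v * ?D)) (f u) = mdist T (F z) (f u)"
        using \<gamma>(4)[rule_format, OF s sD(1)] \<gamma>(1) s Fz by auto
      show "mdist T (\<gamma> (z v * ?D)) (f v) = mdist T (F z) (f v)"
        using \<gamma>(4)[rule_format, OF s sD(2)] \<gamma>(2) s Fz z'(3) by (auto simp: algebra_simps)
    qed (use \<gamma>(3) s uv in auto)
  qed
  have "mdist T (F x) (F y) = \<bar>x v * ?D - y v * ?D\<bar>"
    using \<gamma>(4) in_D F assms(2,3) by simp
  then show ?thesis by (simp add: left_diff_distrib[symmetric] abs_mult)
qed

section \<open>Lipschitz continuity of the interpolation\<close>

lemma d_edge_le:
  assumes "e \<in> E" "x \<in> edge_points e" "y \<in> edge_points e"
  shows "d x y \<le> edge_dist 1 e x y"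
  using shortest_path_dist_edge_le[OF assms, of "\<lambda>e. 1"] by simp

lemma F_edge_dist:
  assumes "{u, v} \<in> E" "x \<in> edge_points {u, v}" "y \<in> edge_points {u, v}"
  shows "mdist T (F x) (F y) = edge_dist 1 {u, v} x y * mdist T (f u) (f v)"
  using F_edge[OF assms] edge_dist_doubleton[OF edgeD(1)[OF assms(1)] assms(2,3)] by simp

lemma f_bounded: "\<exists>B. \<forall>u\<in>V. \<forall>v\<in>V. mdist T (f u) (f v) \<le> B"
proof -
  have "finite ((\<lambda>(u, v). mdist T (f u) (f v)) ` (V \<times> V))" using finite_V by simp
  then obtain B where "\<forall>r\<in>(\<lambda>(u, v). mdist T (f u) (f v)) ` (V \<times> V). r \<le> B"
    using bdd_above_finite unfolding bdd_above_def by blast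
  then show ?thesis by (intro exI[of _ B]) auto
qed

text \<open>\<open>d\<close> is treated as a bare infimum: Lipschitz bounds are proved along
  arbitrary paths and passed on to \<open>d\<close> through paths of almost minimal length.\<close>

lemma le_mult_d:
  assumes "x \<in> X" "y \<in> X" "0 \<le> K"
    and "\<And>L. piecewise_path E (\<lambda>e. 1) x y L \<Longrightarrow> a \<le> K * L"
  shows "a \<le> K * d x y"
proof (rule field_le_epsilon)
  fix e :: real assume "0 < e"
  \<comment> \<open>The summand 1 keeps the denominator positive when \<open>K = 0\<close>.\<close>
  define \<epsilon> where "\<epsilon> = e / (K + 1)"
  have \<epsilon>: "0 < \<epsilon>" "K * \<epsilon> \<le> e" using assms(3) \<open>0 < e\<close> by (auto simp: \<epsilon>_def field_simps)
  obtain L where "piecewise_path E (\<lambda>e. 1) x y L" "L < d x y + \<epsilon>"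
    using piecewise_path_exists[OF connected assms(1,2), of "\<lambda>e. 1"]
      piecewise_path_approx[of E "\<lambda>e. 1" x y _ "d x y + \<epsilon>"] \<epsilon>(1) by auto
  then have "a \<le> K * (d x y + \<epsilon>)"
    using assms(4)[of L] mult_left_mono[of L "d x y + \<epsilon>" K] assms(3) by linarith
  with \<epsilon>(2) show "a \<le> K * d x y + e" by (simp add: distrib_left)
qed

lemma F_Lipschitz: "\<exists>B. \<forall>x\<in>X. \<forall>y\<in>X. mdist T (F x) (F y) \<le> B * d x y"
proof -
  obtain B0 where B0: "\<And>u v. u \<in> V \<Longrightarrow> v \<in> V \<Longrightarrow> mdist T (f u) (f v) \<le> B0"
    using f_bounded by blast
  define B where "B = max B0 0"
  have "mdist T (F x) (F y) \<le> B * L" if "piecewise_path E (\<lambda>e. 1) x y L" "x \<in> X" for x y L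
    using that
  proof induction
    case (refl x)
    then show ?case using F_in_T by simp
  next
    case (step e x y z L)
    obtain u v where e: "e = {u, v}" using edgeE[OF step.hyps(1)] by blast
    have "0 \<le> edge_dist 1 {u, v} x y" by (simp add: edge_dist_nonneg)
    then have "mdist T (F x) (F y) \<le> B * edge_dist 1 e x y"
      using F_edge_dist[of u v x y] step.hyps B0[of u v] edgeD[of u v] unfolding e B_def
      by (simp add: mult.commute[of _ "edge_dist 1 {u, v} x y"] mult_left_mono max.coboundedI1)
    moreover have yX: "y \<in> X" using edge_points_subset_X step.hyps by blast
    moreover have "z \<in> X" using piecewise_path_in_X[OF step.hyps(4) yX] .
    ultimately show ?case
      using step.IH[OF yX] mdist_triangle[of "F x" T "F y" "F z"] F_in_T step.prems
      by (simp add: distrib_left)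
  qed
  then have "\<forall>x\<in>X. \<forall>y\<in>X. mdist T (F x) (F y) \<le> B * d x y"
    by (intro ballI le_mult_d) (auto simp: B_def)
  then show ?thesis by blast
qed

end

section \<open>Following the gradient until it leaves an open set\<close>

locale graph_map_open = graph_map T V E f
  for T :: "'z metric" and V :: "'v set" and E :: "'v set set" and f :: "'v \<Rightarrow> 'z" +
  fixes U :: "('v \<Rightarrow> real) set"
  assumes U_subset: "U \<subseteq> X"
    and U_open: "x \<in> U \<Longrightarrow> \<exists>r>0. \<forall>y\<in>X. d x y < r \<longrightarrow> y \<in> U"
begin

text \<open>As \<open>U\<close> is open, these are its boundary points in \<open>X\<close>; they may
  lie in the interior of an edge.\<close>

definition exit_point :: "('v \<Rightarrow> real) \<Rightarrow> bool" where
  "exit_point q \<longleftrightarrow> q \<in> X - U \<and> (\<forall>\<epsilon>>0. \<exists>p\<in>U. d q p < \<epsilon>)"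

lemma d_edge_segment_le:
  assumes "e \<in> E" "x \<in> edge_points e" "y \<in> edge_points e" "s \<in> {0..1}" "t \<in> {0..1}"
  shows "d (edge_segment x y s) (edge_segment x y t) \<le> \<bar>s - t\<bar>"
proof -
  obtain u v where uv: "e = {u, v}" using edgeE[OF assms(1)] by blast
  then have "u \<noteq> v" using edgeD assms(1) by blast
  then have "edge_dist 1 e x y \<le> 1"
    using edge_dist_doubleton[of u v x y 1] edge_points_doubleton[of u v] assms(2,3) uv
    by (auto simp: abs_le_iff)
  then have "\<bar>s - t\<bar> * edge_dist 1 e x y \<le> \<bar>s - t\<bar>" by (simp add: mult_left_le)
  moreover have "d (edge_segment x y s) (edge_segment x y t) \<le> \<bar>s - t\<bar> * edge_dist 1 e x y"
    using d_edge_le[OF assms(1) edge_segment_in_edge_points edge_segment_in_edge_points, of x y s x y t]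
      assms by (simp add: edge_dist_edge_segment)
  ultimately show ?thesis by linarith
qed

text \<open>The first parameter outside \<open>U\<close> is the infimum of a set that openness of
  \<open>U\<close> makes closed; it is positive because the segment starts in
  \<open>U\<close>.\<close>

lemma edge_segment_exit:
  assumes "e \<in> E" "x \<in> edge_points e" "y \<in> edge_points e" "x \<in> U"
  obtains "\<And>t. t \<in> {0..1} \<Longrightarrow> edge_segment x y t \<in> U"
  | t where "0 < t" "t \<le> 1" "exit_point (edge_segment x y t)"
      "\<And>s. s \<in> {0..<t} \<Longrightarrow> edge_segment x y s \<in> U"
proof (cases "\<forall>t\<in>{0..1}. edge_segment x y t \<in> U")
  case True
  then show ?thesis using that(1) by blast
next
  case False
  let ?s = "edge_segment x y"
  define B where "B = {t \<in> {0..1}. ?s t \<notin> U}"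
  have ne: "B \<noteq> {}" using False by (auto simp: B_def)
  have bdd: "bdd_below B" by (intro bdd_belowI[of _ 0]) (auto simp: B_def)
  define t where "t = Inf B"
  have t01: "t \<in> {0..1}"
  proof -
    obtain b where "b \<in> B" using ne by blast
    then have "t \<le> 1" using cInf_lower[OF _ bdd] unfolding t_def by (force simp: B_def)
    moreover have "0 \<le> t" unfolding t_def using ne by (intro cInf_greatest) (auto simp: B_def)
    ultimately show ?thesis by simp
  qed
  have sX: "?s r \<in> X" if "r \<in> {0..1}" for r
    using edge_segment_in_edge_points[OF assms(2,3) that] edge_points_subset_X[OF assms(1)] by blast
  have before: "?s r \<in> U" if "r \<in> {0..<t}" for r
  proof (rule ccontr)
    assume "?s r \<notin> U"
    then have "r \<in> B" using that t01 by (auto simp: B_def)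
    then show False using cInf_lower[OF _ bdd] that unfolding t_def by fastforce
  qed
  have tU: "?s t \<notin> U"
  proof
    assume "?s t \<in> U"
    then obtain r where r: "0 < r" "\<And>p. p \<in> X \<Longrightarrow> d (?s t) p < r \<Longrightarrow> p \<in> U" using U_open by blast
    then obtain b where b: "b \<in> B" "b < t + r"
      using cInf_lessD[OF ne, of "t + r"] unfolding t_def by auto
    then have "t \<le> b" using cInf_lower[OF _ bdd] unfolding t_def by blast
    have b01: "b \<in> {0..1}" using b(1) by (simp add: B_def)
    have "d (?s t) (?s b) < r"
      using d_edge_segment_le[OF assms(1-3) t01 b01] b(2) \<open>t \<le> b\<close> by simp
    then show False using r(2)[OF sX[OF b01]] b(1) by (simp add: B_def)
  qed
  have "t \<noteq> 0" using tU assms(4) by auto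
  then have "0 < t" using t01 by simp
  have "exit_point (?s t)"
    unfolding exit_point_def
  proof (intro conjI allI impI)
    fix \<epsilon> :: real assume "0 < \<epsilon>"
    \<comment> \<open>A point of the segment shortly before \<open>t\<close>; the maximum keeps it
      on the segment when \<open>\<epsilon>\<close> is large.\<close>
    define r where "r = max 0 (t - \<epsilon> / 2)"
    have r: "r \<in> {0..<t}" "\<bar>t - r\<bar> < \<epsilon>" using \<open>0 < \<epsilon>\<close> \<open>0 < t\<close> by (auto simp: r_def)
    then have "r \<in> {0..1}" using t01 by auto
    then have "d (?s t) (?s r) < \<epsilon>" using d_edge_segment_le[OF assms(1-3) t01] r(2) by fastforce
    then show "\<exists>p\<in>U. d (?s t) p < \<epsilon>" using before[OF r(1)] by blast
  qed (use sX[OF t01] tU in blast)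
  then show ?thesis using that(2) \<open>0 < t\<close> t01 before by auto
qed

lemma F_edge_segment_between:
  assumes "{a, b} \<in> E" "x \<in> edge_points {a, b}" "t \<in> {0..1}"
  shows "between T (F x) (F (edge_segment x (vertex b) t)) (f b)"
proof -
  note vb = vertex_in_edge(2)[OF assms(1)]
  note q = edge_segment_in_edge_points[OF assms(2) vb assms(3)]
  note ab = edgeD[OF assms(1)]
  have x: "0 \<le> x b" "x b \<le> 1" using assms(2) ab(1) by (auto simp: edge_points_doubleton)
  have qb: "edge_segment x (vertex b) t b = x b + t * (1 - x b)"
    by (simp add: edge_segment_def vertex_def algebra_simps)
  have "t * (1 - x b) \<le> 1 - x b" "0 \<le> t * (1 - x b)"
    using x assms(3) by (auto intro: mult_left_le_one_le)
  then have "\<bar>x b - 1\<bar> = \<bar>x b - edge_segment x (vertex b) t b\<bar> + \<bar>edge_segment x (vertex b) t b - 1\<bar>"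
    using x qb by simp
  then show ?thesis
    using F_edge[OF assms(1,2) q] F_edge[OF assms(1) q vb] F_edge[OF assms(1,2) vb]
      F_vertex[OF ab(3)]
    by (simp add: between_def vertex_def distrib_right[symmetric])
qed

lemma F_between:
  assumes "{u, v} \<in> E" "p \<in> edge_points {u, v}"
  shows "between T (f u) (F p) (f v)"
proof -
  have "p u + p v = 1" using assms(2) edgeD[OF assms(1)] by (simp add: edge_points_doubleton)
  then have "p v * D + p u * D = D" for D :: real by (metis add.commute distrib_right mult_1)
  then show ?thesis
    using F_edge_vertex[OF assms] by (simp add: between_def mdist_commute[of T "f u" "F p"])
qed

lemma F_edge_ge:
  assumes "{a, b} \<in> E" "x \<in> edge_points {a, b}" "y \<in> edge_points {a, b}"
    and "s \<le> mdist T (f a) (f b)" "0 \<le> s"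
  shows "s * d x y \<le> mdist T (F x) (F y)"
proof -
  have "s * d x y \<le> mdist T (f a) (f b) * edge_dist 1 {a, b} x y"
    using assms d_edge_le[OF assms(1-3)] by (intro mult_mono) auto
  then show ?thesis using F_edge_dist[OF assms(1-3)] by (simp add: mult.commute)
qed

end

section \<open>Steepest walks through harmonic vertices\<close>

locale harmonic_on_open = graph_map_open T V E f U
  for T :: "'z metric" and V :: "'v set" and E :: "'v set set" and f :: "'v \<Rightarrow> 'z"
    and U :: "('v \<Rightarrow> real) set" +
  assumes harmonic: "\<lbrakk>v \<in> V; vertex v \<in> U\<rbrakk> \<Longrightarrow> inf_harmonic_at E T f v"
begin

text \<open>The incoming edge competes in the maximum at \<open>b\<close>, so neither of the two
  opposite edges attaining it is less steep, and at least one of them leads away from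
  \<open>f a\<close>.\<close>

lemma harmonic_continuation:
  assumes "{a, b} \<in> E" "vertex b \<in> U"
  shows "\<exists>w. {b, w} \<in> E \<and> mdist T (f a) (f b) \<le> mdist T (f b) (f w) \<and> between T (f a) (f b) (f w)"
proof -
  note ab = edgeD[OF assms(1)]
  let ?M = "MAX z\<in>nbhd E b. mdist T (f z) (f b)"
  obtain u w where uw: "u \<in> nbhd E b" "w \<in> nbhd E b"
    "mdist T (f u) (f b) = ?M" "mdist T (f w) (f b) = ?M" "mdist T (f u) (f w) = 2 * ?M"
    using harmonic[OF ab(3) assms(2)] by (auto simp: inf_harmonic_at_def)
  have nV: "nbhd E b \<subseteq> V" using edgeD by (auto simp: nbhd_def)
  then have "finite (nbhd E b)" using finite_V finite_subset by blast
  moreover have "a \<in> nbhd E b" using assms(1) by (simp add: nbhd_def)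
  ultimately have M: "mdist T (f a) (f b) \<le> ?M" by (intro Max_ge) auto
  have "between T (f u) (f b) (f w)"
    using uw(3-5) by (simp add: between_def mdist_commute[of T "f b" "f w"])
  then have "between T (f a) (f b) (f u) \<or> between T (f a) (f b) (f w)"
    using uw nV ab by (intro between_one_of_two_directions) auto
  then show ?thesis
    using M uw by (auto simp: nbhd_def insert_commute mdist_commute[of T "f b"])
qed

text \<open>Walking from \<open>x\<close> along the edge \<open>{a, b}\<close> towards \<open>b\<close>, and further along steepest edges, the
  image is a geodesic that never slows down below speed \<open>s\<close>. As the image of \<open>V\<close> is bounded, the
  walk must leave \<open>U\<close>; the natural number \<open>N\<close> bounds the remaining number of edges.\<close>

lemma gradient_exit:
  assumes "0 < s" and B: "\<And>u v. \<lbrakk>u \<in> V; v \<in> V\<rbrakk> \<Longrightarrow> mdist T (f u) (f v) \<le> B"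
    and "c \<in> V"
    and "{a, b} \<in> E" "s \<le> mdist T (f a) (f b)" "x \<in> edge_points {a, b}" "x \<in> U" "x \<noteq> vertex b"
    and "between T (f c) (f a) (f b)" "B < mdist T (f c) (f a) + real N * s"
  shows "\<exists>q. exit_point q \<and> s * d x q \<le> mdist T (F x) (F q) \<and>
    (\<forall>\<tau>\<in>mspace T. between T \<tau> (F x) (f b) \<longrightarrow> between T \<tau> (F x) (F q))"
  using assms(4-)
\<comment> \<open>Progress is measured from the fixed vertex \<open>c\<close>. The clause over all
  \<open>\<tau>\<close> says that the image of the walk sets out from \<open>F x\<close> towards
  \<open>f b\<close>: whatever lies behind \<open>F x\<close> can be prepended, be it an earlier
  edge or a second walk.\<close>
proof (induction N arbitrary: a b x)
  case 0
  then show ?case using B[of c a] \<open>c \<in> V\<close> edgeD(2) by fastforce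
next
  case (Suc N)
  note ab = edgeD[OF Suc.prems(1)]
  note vb = vertex_in_edge(2)[OF Suc.prems(1)]
  have Fx: "F x \<in> mspace T" using F_in_T Suc.prems(4) U_subset by blast
  show ?case
  proof (rule edge_segment_exit[OF Suc.prems(1,3) vb Suc.prems(4)])
    fix t assume t: "0 < t" "t \<le> 1" "exit_point (edge_segment x (vertex b) t)"
    let ?q = "edge_segment x (vertex b) t"
    have t01: "t \<in> {0..1}" using t by simp
    have q: "?q \<in> edge_points {a, b}" by (rule edge_segment_in_edge_points[OF Suc.prems(3) vb t01])
    have Fq: "F ?q \<in> mspace T" using F_in_T t(3) by (auto simp: exit_point_def)
    have "between T \<tau> (F x) (F ?q)" if "\<tau> \<in> mspace T" "between T \<tau> (F x) (f b)" for \<tau>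
      using between_inner_left(1)[OF that(1) Fx Fq _ that(2)
          F_edge_segment_between[OF Suc.prems(1,3) t01]] ab by simp
    then show ?thesis
      using t(3) F_edge_ge[OF Suc.prems(1,3) q Suc.prems(2)] \<open>0 < s\<close> by (intro exI[of _ ?q]) auto
  next
    assume "\<And>t. t \<in> {0..1} \<Longrightarrow> edge_segment x (vertex b) t \<in> U"
    from this[of 1] have bU: "vertex b \<in> U" by simp
    obtain w where w: "{b, w} \<in> E" "mdist T (f a) (f b) \<le> mdist T (f b) (f w)"
      "between T (f a) (f b) (f w)"
      using harmonic_continuation[OF Suc.prems(1) bU] by blast
    note bw = edgeD[OF w(1)]
    have "f a \<noteq> f b" using Suc.prems(2) \<open>0 < s\<close> ab mdist_self[of "f b" T] by auto
    have "between T (f c) (f b) (f w)"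
      using between_extend(1)[OF _ _ _ _ Suc.prems(6) w(3) \<open>f a \<noteq> f b\<close>] \<open>c \<in> V\<close> ab bw by simp
    \<comment> \<open>The edge \<open>{a, b}\<close> adds at least \<open>s\<close> to the distance
      from \<open>f c\<close>, which pays for replacing \<open>Suc N\<close> by
      \<open>N\<close>.\<close>
    moreover have "B < mdist T (f c) (f b) + real N * s"
      using Suc.prems(2,6,7) by (simp add: between_def algebra_simps)
    moreover have "vertex b \<noteq> vertex w" using bw inj_eq[OF inj_vertex] by metis
    ultimately obtain q where q: "exit_point q" "s * d (vertex b) q \<le> mdist T (F (vertex b)) (F q)"
      and q': "\<And>\<tau>. \<lbrakk>\<tau> \<in> mspace T; between T \<tau> (f b) (f w)\<rbrakk> \<Longrightarrow> between T \<tau> (f b) (F q)"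
      using Suc.IH[OF w(1) _ vertex_in_edge(1)[OF w(1)] bU] Suc.prems(2) w(2) F_vertex[OF ab(3)]
      by auto
    have qX: "q \<in> X" and Fq: "F q \<in> mspace T" using F_in_T q by (auto simp: exit_point_def)
    have xb: "between T (f a) (F x) (f b)"
      by (rule F_between[OF Suc.prems(1,3)])
    \<comment> \<open>Prolonging a chain across \<open>f b\<close> takes
      \<open>F x \<noteq> f b\<close>: the slope is positive and \<open>x\<close> is not yet at
      \<open>b\<close>.\<close>
    have "x b \<noteq> 1" using Suc.prems(3,5) edge_points_eq_vertex[OF ab(1), of x] ab(1)
      by (auto simp: edge_points_doubleton)
    then have "x a \<noteq> 0" using Suc.prems(3) ab(1) by (auto simp: edge_points_doubleton)
    then have "F x \<noteq> f b"
      using F_edge_vertex(2)[OF Suc.prems(1,3)] \<open>f a \<noteq> f b\<close> ab Fx by auto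
    have bT: "f a \<in> mspace T" "f b \<in> mspace T" "f w \<in> mspace T" using ab bw by simp_all
    have xbw: "between T (F x) (f b) (f w)"
      by (rule between_inner_right(2)[OF bT(1) Fx bT(2,3) w(3) xb])
    have xbq: "between T (F x) (f b) (F q)" by (rule q'[OF Fx xbw])
    have "between T \<tau> (F x) (F q)" if \<tau>: "\<tau> \<in> mspace T" "between T \<tau> (F x) (f b)" for \<tau>
    proof -
      have "between T \<tau> (f b) (f w)"
        by (rule between_extend(1)[OF \<tau>(1) Fx bT(2,3) \<tau>(2) xbw \<open>F x \<noteq> f b\<close>])
      then have "between T \<tau> (f b) (F q)" by (rule q'[OF \<tau>(1)])
      then show ?thesis by (rule between_inner_right(1)[OF \<tau>(1) Fx bT(2) Fq _ \<tau>(2)])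
    qed
    moreover have "s * d x q \<le> mdist T (F x) (F q)"
    proof -
      have "s * d x q \<le> s * d x (vertex b) + s * d (vertex b) q"
        using X.triangle[of x "vertex b" q] Suc.prems(4) U_subset bU qX \<open>0 < s\<close>
        by (auto simp: distrib_left[symmetric])
      also have "\<dots> \<le> mdist T (F x) (f b) + mdist T (f b) (F q)"
        using F_edge_ge[OF Suc.prems(1,3) vb Suc.prems(2)] q(2) F_vertex[OF ab(3)] \<open>0 < s\<close> by simp
      also have "\<dots> = mdist T (F x) (F q)" using xbq by (simp add: between_def)
      finally show ?thesis .
    qed
    ultimately show ?thesis using q(1) by blast
  qed
qed

text \<open>Following the gradient in both directions from \<open>p\<close> yields two boundary points at which the
  Lipschitz bound \<open>K\<close> fails if the slope along the edge of \<open>p\<close> exceeds \<open>K\<close>.\<close>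

lemma slope_le:
  assumes "0 \<le> K"
    and K: "\<forall>p q. exit_point p \<and> exit_point q \<longrightarrow> mdist T (F p) (F q) \<le> K * d p q"
    and "{u, v} \<in> E" "p \<in> edge_points {u, v}" "p \<in> U" "0 < p u" "0 < p v"
  shows "mdist T (f u) (f v) \<le> K"
proof (rule ccontr)
  let ?s = "mdist T (f u) (f v)"
  assume "\<not> ?s \<le> K"
  then have s: "K < ?s" "0 < ?s" using \<open>0 \<le> K\<close> by auto
  note uv = edgeD[OF assms(3)]
  obtain B where B: "\<And>u v. \<lbrakk>u \<in> V; v \<in> V\<rbrakk> \<Longrightarrow> mdist T (f u) (f v) \<le> B" using f_bounded by blast
  \<comment> \<open>Each walk takes as \<open>c\<close> the tail of its first edge, at distance 0,
    so \<open>N\<close> edges of image length \<open>?s\<close> have to exceed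
    \<open>B\<close>.\<close>
  obtain N where N: "B < real N * ?s" using reals_Archimedean3[OF s(2)] by blast
  have pv: "p \<noteq> vertex v" "p \<noteq> vertex u" using assms(6,7) uv(1) by (auto simp: vertex_def)
  have pX: "p \<in> X" and Fp: "F p \<in> mspace T" using F_in_T assms(5) U_subset by blast+
  have triv: "between T (f a) (f a) (f b)" if "a \<in> V" for a b using that by (simp add: between_def)
  obtain q where q: "exit_point q" "?s * d p q \<le> mdist T (F p) (F q)"
    and q': "\<And>\<tau>. \<lbrakk>\<tau> \<in> mspace T; between T \<tau> (F p) (f v)\<rbrakk> \<Longrightarrow> between T \<tau> (F p) (F q)"
    using gradient_exit[OF s(2) B uv(2) assms(3) order_refl assms(4,5) pv(1) triv[OF uv(2)], of N] N uv
    by auto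
  have vu: "{v, u} \<in> E" "p \<in> edge_points {v, u}" "?s \<le> mdist T (f v) (f u)"
    using assms(3,4) by (simp_all add: insert_commute mdist_commute)
  obtain r where r: "exit_point r" "?s * d p r \<le> mdist T (F p) (F r)"
    and r': "\<And>\<tau>. \<lbrakk>\<tau> \<in> mspace T; between T \<tau> (F p) (f u)\<rbrakk> \<Longrightarrow> between T \<tau> (F p) (F r)"
    using gradient_exit[OF s(2) B uv(3) vu(1,3,2) assms(5) pv(2) triv[OF uv(3)], of N] N uv
    by auto
  have qX: "q \<in> X" "F q \<in> mspace T" and rX: "r \<in> X" using F_in_T q(1) r(1) by (auto simp: exit_point_def)
  \<comment> \<open>The two walks are glued at \<open>F p\<close> through their clauses on
    \<open>\<tau>\<close>: the first with \<open>\<tau> = f u\<close>, the second with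
    \<open>\<tau> = F q\<close>.\<close>
  have "between T (f u) (F p) (F q)" using q' F_between[OF assms(3,4)] uv by simp
  then have "between T (F q) (F p) (F r)" by (rule r'[OF qX(2) between_commute])
  then have eq: "mdist T (F q) (F r) = mdist T (F p) (F q) + mdist T (F p) (F r)"
    by (simp add: between_def mdist_commute[of T "F q" "F p"])
  have "?s * d q r \<le> ?s * (d p q + d p r)"
    using X.triangle[of q p r] X.commute[of q p] qX rX pX s(2) by (intro mult_left_mono) auto
  also have "\<dots> \<le> mdist T (F q) (F r)" using q(2) r(2) eq by (simp add: distrib_left)
  finally have le: "?s * d q r \<le> mdist T (F q) (F r)" .
  with K[rule_format, OF conjI[OF q(1) r(1)]] have "?s * d q r \<le> K * d q r" by linarith
  \<comment> \<open>Since \<open>?s\<close> exceeds \<open>K\<close>, only \<open>d q r = 0\<close>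
    is left. Then \<open>F p = F q\<close>, and positive speed forces \<open>p = q\<close>, although
    \<open>q\<close> lies outside \<open>U\<close>.\<close>
  then have "d q r \<le> 0" using s(1) by (smt (verit) mult_right_less_imp_less mult_strict_right_mono)
  then have "d q r = 0" using X.nonneg[of q r] by simp
  then have "mdist T (F p) (F q) \<le> 0"
    using K[rule_format, OF conjI[OF q(1) r(1)]] eq mdist_nonneg[of T "F p" "F r"]
    by (simp only: mult_zero_right)
  then have "?s * d p q \<le> 0" using q(2) by linarith
  then have "d p q \<le> 0" using s(2) by (simp add: mult_le_0_iff)
  then have "p = q" using X.zero[OF pX qX(1)] X.nonneg[of p q] by simp
  then show False using q(1) assms(5) by (simp add: exit_point_def)
qed

text \<open>\<open>slope_le\<close> asks for a point of \<open>U\<close> inside the edge, and the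
  end at \<open>t\<close> may lie outside \<open>U\<close>; the midpoint of the part travelled
  serves, unless that part is a single point.\<close>

lemma F_edge_segment_le:
  assumes "0 \<le> K"
    and K: "\<forall>p q. exit_point p \<and> exit_point q \<longrightarrow> mdist T (F p) (F q) \<le> K * d p q"
    and "e \<in> E" "x \<in> edge_points e" "y \<in> edge_points e"
    and "0 < t" "t \<le> 1" "\<And>s. s \<in> {0..<t} \<Longrightarrow> edge_segment x y s \<in> U"
  shows "mdist T (F x) (F (edge_segment x y t)) \<le> K * edge_dist 1 e x (edge_segment x y t)"
proof -
  obtain u v where e: "e = {u, v}" using edgeE[OF assms(3)] by blast
  then have uv: "{u, v} \<in> E" "u \<noteq> v" using assms(3) edgeD by blast+
  let ?q = "edge_segment x y t" and ?m = "edge_segment x y (t / 2)"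
  have q: "?q \<in> edge_points {u, v}" and m: "?m \<in> edge_points {u, v}"
    using assms(4-7) e by (auto intro!: edge_segment_in_edge_points)
  have x: "x \<in> edge_points {u, v}" using assms(4) e by simp
  have eq: "mdist T (F x) (F ?q) = edge_dist 1 e x ?q * mdist T (f u) (f v)"
    using F_edge_dist[OF uv(1) x q] e by simp
  show ?thesis
  proof (cases "x v = ?q v")
    case True
    then have "edge_dist 1 e x ?q = 0" using edge_dist_doubleton[OF uv(2) x q] e by simp
    then show ?thesis using eq by simp
  next
    case False
    have mid: "?m w = (x w + ?q w) / 2" for w
      by (simp add: edge_segment_def field_simps)
    have c: "0 \<le> x u" "0 \<le> x v" "x u + x v = 1" "0 \<le> ?q u" "0 \<le> ?q v" "?q u + ?q v = 1"
      using x q uv(2) by (auto simp: edge_points_doubleton)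
    from False have "0 < x u + ?q u" "0 < x v + ?q v" using c by (auto simp: less_le)
    then have "0 < ?m u" "0 < ?m v" unfolding mid by simp_all
    moreover have "?m \<in> U" using assms(6,8) by simp
    ultimately have "mdist T (f u) (f v) \<le> K" using slope_le[OF assms(1) K uv(1) m] by blast
    then show ?thesis
      unfolding eq by (simp add: mult.commute mult_right_mono edge_dist_nonneg)
  qed
qed

text \<open>Cuts a path at its first exit from \<open>U\<close>. Beyond it the path may re-enter
  \<open>U\<close>, so only the distance to its end is kept, bounded by the remaining
  length.\<close>

lemma F_path_le:
  assumes "0 \<le> K"
    and K: "\<forall>p q. exit_point p \<and> exit_point q \<longrightarrow> mdist T (F p) (F q) \<le> K * d p q"
    and "piecewise_path E (\<lambda>e. 1) x y L" "x \<in> U"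
  shows "y \<in> U \<and> mdist T (F x) (F y) \<le> K * L \<or>
    (\<exists>q L1 L2. exit_point q \<and> L1 + L2 = L \<and> mdist T (F x) (F q) \<le> K * L1 \<and> d q y \<le> L2)"
  using assms(3,4)
proof induction
  case (refl x)
  then have "mdist T (F x) (F x) = 0" using F_in_T U_subset by auto
  then show ?case using refl by simp
next
  case (step e x y z L)
  let ?l = "edge_dist 1 e x y"
  show ?case
  proof (rule edge_segment_exit[OF step.hyps(1-3) step.prems])
    assume "\<And>t. t \<in> {0..1} \<Longrightarrow> edge_segment x y t \<in> U"
    then have U: "edge_segment x y t \<in> U" if "t \<in> {0..1}" for t using that by blast
    have yU: "y \<in> U" using U[of 1] by simp
    have xy: "mdist T (F x) (F y) \<le> K * ?l"
      using F_edge_segment_le[OF assms(1) K step.hyps(1-3), of 1] U by simp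
    have tri: "mdist T (F x) (F p) \<le> mdist T (F x) (F y) + mdist T (F y) (F p)" if "p \<in> X" for p
      using mdist_triangle[of "F x" T "F y" "F p"] F_in_T step.prems yU U_subset that by blast
    from step.IH[OF yU] show ?thesis
    proof (elim disjE exE conjE)
      assume "z \<in> U" "mdist T (F y) (F z) \<le> K * L"
      then show ?thesis using tri[of z] xy U_subset by (auto simp: distrib_left)
    next
      fix q L1 L2
      assume q: "exit_point q" "L1 + L2 = L" "mdist T (F y) (F q) \<le> K * L1" "d q z \<le> L2"
      then have "mdist T (F x) (F q) \<le> K * (?l + L1)"
        using tri[of q] xy by (simp add: exit_point_def distrib_left)
      then show ?thesis
        using q by (intro disjI2 exI[of _ q] exI[of _ "?l + L1"] exI[of _ L2]) auto
    qed
  next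
    fix t assume t: "0 < t" "t \<le> 1" "exit_point (edge_segment x y t)"
      and U: "\<And>s. s \<in> {0..<t} \<Longrightarrow> edge_segment x y s \<in> U"
    let ?q = "edge_segment x y t"
    have q: "?q \<in> edge_points e" using t step.hyps by (intro edge_segment_in_edge_points) auto
    have l: "edge_dist 1 e x ?q = t * ?l" "edge_dist 1 e ?q y = (1 - t) * ?l"
      using edge_dist_edge_segment[of 1 e x y 0 t] edge_dist_edge_segment[of 1 e x y t 1] t by simp_all
    have "mdist T (F x) (F ?q) \<le> K * (t * ?l)"
      using F_edge_segment_le[OF assms(1) K step.hyps(1-3) t(1,2) U] l by simp
    moreover have "piecewise_path E (\<lambda>e. 1) ?q z ((1 - t) * ?l + L)"
      using piecewise_path.step[OF step.hyps(1) q step.hyps(3,4)] l(2) by simp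
    then have "d ?q z \<le> (1 - t) * ?l + L" by (intro shortest_path_dist_le) auto
    ultimately show ?thesis
      using t(3) by (intro disjI2 exI[of _ ?q] exI[of _ "t * ?l"] exI[of _ "(1 - t) * ?l + L"])
        (auto simp: algebra_simps)
  qed
qed

lemma F_le:
  assumes "0 \<le> K"
    and K: "\<forall>p q. exit_point p \<and> exit_point q \<longrightarrow> mdist T (F p) (F q) \<le> K * d p q"
    and "x \<in> U" "y \<in> U"
  shows "mdist T (F x) (F y) \<le> K * d x y"
proof (rule le_mult_d)
  show "x \<in> X" "y \<in> X" using assms U_subset by blast+
  fix L assume L: "piecewise_path E (\<lambda>e. 1) x y L"
  show "mdist T (F x) (F y) \<le> K * L"
    using F_path_le[OF assms(1) K L assms(3)]
  proof (elim disjE exE conjE)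
    fix p L1 L2
    assume p: "exit_point p" "L1 + L2 = L" "mdist T (F x) (F p) \<le> K * L1" "d p y \<le> L2"
    have pX: "p \<in> X" using p by (simp add: exit_point_def)
    have X: "x \<in> X" "y \<in> X" using assms U_subset by blast+
    \<comment> \<open>The last exit is found as the first one seen from \<open>y\<close>, on
      arbitrary paths to \<open>p\<close>. Such a path has to exit because \<open>p\<close> lies
      outside \<open>U\<close>, and \<open>K\<close> covers the part between two exits.\<close>
    have "mdist T (F y) (F p) \<le> K * d y p"
    proof (rule le_mult_d[OF X(2) pX assms(1)])
      fix M assume M: "piecewise_path E (\<lambda>e. 1) y p M"
      have "p \<notin> U" using p(1) by (simp add: exit_point_def)
      then obtain q M1 M2 where q: "exit_point q" "M1 + M2 = M" "mdist T (F y) (F q) \<le> K * M1"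
        "d q p \<le> M2"
        using F_path_le[OF assms(1) K M assms(4)] by blast
      have "mdist T (F q) (F p) \<le> K * M2"
        using K[rule_format, OF conjI[OF q(1) p(1)]] mult_left_mono[OF q(4) assms(1)] by linarith
      moreover have "mdist T (F y) (F p) \<le> mdist T (F y) (F q) + mdist T (F q) (F p)"
        using q(1) pX X F_in_T by (intro mdist_triangle) (auto simp: exit_point_def)
      ultimately show "mdist T (F y) (F p) \<le> K * M"
        using q(2,3) by (simp add: distrib_left flip: q(2))
    qed
    also have "\<dots> \<le> K * L2" using p(4) assms(1) X.commute[of p y] by (simp add: mult_left_mono)
    finally have "mdist T (F p) (F y) \<le> K * L2" by (simp add: mdist_commute)
    moreover have "mdist T (F x) (F y) \<le> mdist T (F x) (F p) + mdist T (F p) (F y)"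
      using pX X F_in_T by (intro mdist_triangle) auto
    ultimately show ?thesis using p(3) by (simp add: distrib_left flip: p(2))
  qed simp
qed (rule assms(1))

end

text \<open>The crude global constant \<open>B\<close> is good enough for moving the two exit points
  into \<open>U\<close> at vanishing cost; between the moved points the sharp constant
  \<open>K\<close> applies.\<close>

lemma (in graph_map_open) exit_point_bound:
  assumes h: "\<And>x. x \<in> X \<Longrightarrow> h x \<in> mspace T"
    and Lip: "0 \<le> B" "\<And>x y. \<lbrakk>x \<in> X; y \<in> X\<rbrakk> \<Longrightarrow> mdist T (h x) (h y) \<le> B * d x y"
    and K: "0 \<le> K" "\<And>x y. \<lbrakk>x \<in> U; y \<in> U\<rbrakk> \<Longrightarrow> mdist T (h x) (h y) \<le> K * d x y"
    and pq: "exit_point p" "exit_point q"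
  shows "mdist T (h p) (h q) \<le> K * d p q"
proof (rule field_le_epsilon)
  fix e :: real assume "0 < e"
  \<comment> \<open>Moving each point costs \<open>B * \<epsilon>\<close> and lengthens the inner
    distance by up to \<open>\<epsilon>\<close>; the summand 1 keeps the denominator
    positive.\<close>
  define \<epsilon> where "\<epsilon> = e / (2 * B + 2 * K + 1)"
  have \<epsilon>: "0 < \<epsilon>" "(2 * B + 2 * K) * \<epsilon> \<le> e"
    using Lip(1) K(1) \<open>0 < e\<close> by (auto simp: \<epsilon>_def field_simps)
  obtain p' q' where p': "p' \<in> U" "d p p' < \<epsilon>" and q': "q' \<in> U" "d q q' < \<epsilon>"
    using pq \<epsilon>(1) unfolding exit_point_def by blast
  have X: "p \<in> X" "q \<in> X" "p' \<in> X" "q' \<in> X"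
    using pq p' q' U_subset by (auto simp: exit_point_def)
  have "mdist T (h p) (h q) \<le> mdist T (h p) (h p') + mdist T (h p') (h q') + mdist T (h q') (h q)"
    using mdist_triangle[of "h p" T "h p'" "h q"] mdist_triangle[of "h p'" T "h q'" "h q"] h X
    by fastforce
  also have "\<dots> \<le> B * \<epsilon> + K * (d p q + 2 * \<epsilon>) + B * \<epsilon>"
  proof (intro add_mono)
    show "mdist T (h p) (h p') \<le> B * \<epsilon>"
      using Lip(2)[OF X(1,3)] mult_left_mono[OF less_imp_le[OF p'(2)] Lip(1)] by linarith
    show "mdist T (h q') (h q) \<le> B * \<epsilon>"
      using Lip(2)[OF X(2,4)] mult_left_mono[OF less_imp_le[OF q'(2)] Lip(1)]
        mdist_commute[of T "h q'" "h q"] by linarith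
    have "d p' q' \<le> d p q + 2 * \<epsilon>"
      using X.triangle[OF X(3,1,4)] X.triangle[OF X(1,2,4)] X.commute[of p' p] p'(2) q'(2) by linarith
    then show "mdist T (h p') (h q') \<le> K * (d p q + 2 * \<epsilon>)"
      using K(2)[OF p'(1) q'(1)] mult_left_mono[OF _ K(1)] by fastforce
  qed
  also have "\<dots> \<le> K * d p q + e" using \<epsilon>(2) by (simp add: algebra_simps)
  finally show "mdist T (h p) (h q) \<le> K * d p q + e" .
qed

section \<open>Absolute minimality\<close>

lemma mdist_le_if_Lip_on_le:
  assumes "S \<subseteq> mspace Z" "\<And>x. x \<in> S \<Longrightarrow> h x \<in> mspace W" "Lip_on Z W S h \<le> ennreal K" "0 \<le> K"
    and "x \<in> S" "y \<in> S"
  shows "mdist W (h x) (h y) \<le> K * mdist Z x y"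
proof (cases "x = y")
  case True
  then show ?thesis using assms by auto
next
  case False
  have pos: "0 < mdist Z x y"
    using False assms(1,5,6) mdist_zero[of x Z y] mdist_nonneg[of Z x y] by (simp add: subset_iff less_le)
  have "ennreal (mdist W (h x) (h y) / mdist Z x y) \<le> Lip_on Z W S h"
    unfolding Lip_on_def using False assms(5,6) by (intro SUP_upper2[of "(x, y)"]) auto
  then have "ennreal (mdist W (h x) (h y) / mdist Z x y) \<le> ennreal K" using assms(3) by (rule order_trans)
  then have "mdist W (h x) (h y) / mdist Z x y \<le> K" using assms(4) by simp
  then show ?thesis using pos by (simp add: divide_le_eq)
qed

lemma Lip_on_le:
  assumes "S \<subseteq> mspace Z" "\<And>x y. \<lbrakk>x \<in> S; y \<in> S\<rbrakk> \<Longrightarrow> mdist W (h x) (h y) \<le> K * mdist Z x y"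
  shows "Lip_on Z W S h \<le> ennreal K"
  unfolding Lip_on_def
proof (rule SUP_least, clarify)
  fix x y assume xy: "x \<in> S" "y \<in> S" "x \<noteq> y"
  then have "0 < mdist Z x y"
    using assms(1) mdist_zero[of x Z y] mdist_nonneg[of Z x y] by (simp add: subset_iff less_le)
  with assms(2)[OF xy(1,2)]
  show "ennreal (mdist W (h x) (h y) / mdist Z x y) \<le> ennreal K"
    by (intro ennreal_leI) (simp add: divide_le_eq)
qed

theorem (in graph_map) linear_interpolation_AMLE:
  assumes "\<Omega> \<subseteq> V" "inf_harmonic_on E T f (V - \<Omega>)"
  shows "AMLE (unit_complex V E) T (vertex ` \<Omega>) (f \<circ> inv vertex) F"
  unfolding AMLE_def
proof (intro conjI allI impI)
  let ?G = "unit_complex V E"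
  note G = mspace_unit_complex mdist_unit_complex
  have top: "mtopology_of ?G = X.mtopology" by (simp add: mtopology_of_def G)
  have \<Omega>X: "vertex ` \<Omega> \<subseteq> X" using assms(1) vertex_in_X by auto
  have "finite \<Omega>" using assms(1) finite_V finite_subset by blast
  then show "closedin (mtopology_of ?G) (vertex ` \<Omega>)"
    unfolding top using \<Omega>X by (intro closedin_Hausdorff_finite X.Hausdorff_space_mtopology) auto
  show LipF: "Lipschitz_continuous_map ?G T F"
    unfolding Lipschitz_continuous_map_def G using F_in_T F_Lipschitz by blast
  have Ff: "F y = (f \<circ> inv vertex) y" if "y \<in> vertex ` \<Omega>" for y
    using that F_vertex[OF subsetD[OF assms(1)]] by (auto simp: inv_f_f[OF inj_vertex])
  then show "\<forall>y\<in>vertex ` \<Omega>. F y = (f \<circ> inv vertex) y" by blast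
  show "Lipschitz_continuous_map (submetric ?G (vertex ` \<Omega>)) T (f \<circ> inv vertex)"
    using Lipschitz_continuous_map_from_submetric[OF LipF] Ff
    by (rule Lipschitz_continuous_map_eq) simp
  fix U h
  assume "openin (mtopology_of ?G) U \<and> U \<subseteq> mspace ?G - vertex ` \<Omega> \<and>
    Lipschitz_continuous_map ?G T h \<and> (\<forall>x\<in>mspace ?G - U. h x = F x)"
  then have U: "openin X.mtopology U" "U \<subseteq> X" "U \<inter> vertex ` \<Omega> = {}"
    and h: "Lipschitz_continuous_map ?G T h" and hF: "\<And>x. x \<in> X - U \<Longrightarrow> h x = F x"
    unfolding top G by auto
  interpret harmonic_on_open T V E f U
  proof
    show "U \<subseteq> X" by (rule U(2))
    show "\<exists>r>0. \<forall>y\<in>X. d x y < r \<longrightarrow> y \<in> U" if "x \<in> U" for x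
      using that U(1,2) unfolding X.openin_mtopology X.mball_def by blast
    show "inf_harmonic_at E T f v" if "v \<in> V" "vertex v \<in> U" for v
      using that U(3) assms(2) by (auto simp: inf_harmonic_on_def)
  qed
  obtain B where B: "0 < B" "\<And>x y. \<lbrakk>x \<in> X; y \<in> X\<rbrakk> \<Longrightarrow> mdist T (h x) (h y) \<le> B * d x y"
    using h unfolding Lipschitz_continuous_map_pos G by blast
  have hT: "h x \<in> mspace T" if "x \<in> X" for x
    using h that unfolding Lipschitz_continuous_map_def G by blast
  \<comment> \<open>The supremum lives in \<open>ennreal\<close>; Lipschitz continuity of
    \<open>h\<close> makes it finite, hence a real constant \<open>K\<close>.\<close>
  have "Lip_on ?G T U h \<le> ennreal B"
    using B(2) U(2) by (intro Lip_on_le) (auto simp: G)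
  then obtain K where K: "Lip_on ?G T U h = ennreal K" "0 \<le> K"
    by (cases "Lip_on ?G T U h") (auto simp: top_unique)
  have hK: "mdist T (h x) (h y) \<le> K * d x y" if "x \<in> U" "y \<in> U" for x y
    using mdist_le_if_Lip_on_le[of U ?G h T K x y] K U(2) hT that by (auto simp: G)
  \<comment> \<open>Exit points lie outside \<open>U\<close>, where \<open>h\<close> and
    \<open>F\<close> agree, so the bound for \<open>h\<close> carries over.\<close>
  have "mdist T (F p) (F q) \<le> K * d p q" if "exit_point p" "exit_point q" for p q
    using exit_point_bound[OF hT less_imp_le[OF B(1)] B(2) K(2) hK that] hF that
    by (simp add: exit_point_def)
  then have "mdist T (F x) (F y) \<le> K * d x y" if "x \<in> U" "y \<in> U" for x y
    using F_le[OF K(2) _ that] by blast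
  then show "Lip_on ?G T U F \<le> Lip_on ?G T U h"
    unfolding K(1) using U(2) by (intro Lip_on_le) (auto simp: G)
qed

theorem theorem2:
  fixes V \<Omega> :: "'v set" and E :: "'v set set"
    and T :: "('b \<Rightarrow> real) metric" and f :: "'v \<Rightarrow> 'b \<Rightarrow> real"
  assumes "metric_tree T"
    and "finite_connected_graph V E"
    and "\<Omega> \<subseteq> V"
    and "f \<in> V \<rightarrow> mspace T"
    and "inf_harmonic_on E T f (V - \<Omega>)"
  shows "AMLE (unit_complex V E) T (vertex ` \<Omega>) (f \<circ> inv vertex) (linear_interpolation V E T f)"
proof -
  interpret real_tree T by (rule metric_tree_real_tree[OF assms(1)])
  interpret graph_map T V E f by standard (use assms in auto)
  show ?thesis by (rule linear_interpolation_AMLE[OF assms(3,5)])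
qed

end
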